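(* Fix $\lambda_1,\mu_1,\mu_2>0$ with $\rho_1=\lambda_1/\mu_1<1$ and positive integers $k_1,k_2$. For small $\delta>0$ let $\lambda_2=\lambda_2(\delta)=\mu_2\big((1-\rho_1)-\delta\big)$, and assume that $\lambda_1/k_1<\lambda_2/k_2$ for all sufficiently small $\delta>0$. Let $(N_1,N_2)=(N_1^{(\delta)},N_2^{(\delta)})$ be the pair of steady-state queue lengths in the two-queue $k$-limited polling model with zero switch-over times and parameters $\lambda_1,\lambda_2(\delta),\mu_1,\mu_2,k_1,k_2$. Then for every integer $n_1\ge 0$ and every real $\xi>0$, $$\lim_{\delta\downarrow 0}\mathbb{P}\big[N_1\le n_1,\ \delta N_2\le \xi\big]=\mathcal{L}(n_1)\left(1-e^{-\eta\xi}\right),\qquad \frac1\eta = 1-\frac{\lambda_1}{\mu_1}+\mu_2\frac{\lambda_1}{\mu_1^2},$$ where $\mathcal{L}(\cdot)$ is the cumulative distribution function of the stationary number of customers in the single-server $k_1$-limited multiple-vacation queue with Poisson($\lambda_1$) arrivals, exponential($\mu_1$) service times and Erlang-$k_2$ vacations with parameter $\mu_2$.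
   Context: Polling model: two queues $Q_1,Q_2$ are visited alternately by a single server. Customers arrive at $Q_i$ according to independent Poisson processes with rates $\lambda_i$; service times at $Q_i$ are independent and exponentially distributed with parameter $\mu_i$ (all independent of the arrivals). On a visit to $Q_i$ the server serves customers until either $k_i$ customers have been served in this visit or $Q_i$ becomes empty, whichever occurs first; it then switches to the other queue, taking zero time. If the other queue is empty, the server switches back and again serves at most $k_i$ customers. If both queues are empty, the server waits for the first arrival and switches to the corresponding queue $Q_j$ to start a visit period of at most $k_j$ customers. $N_i(t)$ is the number of customers in $Q_i$ (including the one in service) at time $t$. With $\rho_i=\lambda_i/\mu_i$, the system is stable when $\rho_1+\rho_2<1$, and $(N_1,N_2)$ denotes a pair having the stationary (steady-state) distribution of $(N_1(t),N_2(t))$. Here $\rho_1+\rho_2=1-\delta$. Vacation queue: a single-server queue with the following properties: (P1) Poisson arrivals with intensity $\lambda_1$; (P2) exponentially distributed service times with mean $1/\mu_1$; (P3) $k$-limited service with service limit $k_1$, i.e. in each visit period the server serves until $k_1$ customers have been served or the queue is empty, and then takes a vacation; (P4) vacation lengths are Erlang-$k_2$ distributed with parameter $\mu_2$ (sum of $k_2$ independent exponential($\mu_2$) variables); (P5) whenever the server finds the system empty upon return from a vacation, it immediately starts another vacation. $\mathcal L(n)$ is the stationary probability (at an arbitrary time) that the number of customers in the system, including any in service, is at most $n$. *)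

theory Defs
  imports "HOL-Probability.Probability"
begin

section \<open>Stationary distributions of continuous-time Markov chains\<close>

text \<open>
  A chain is described by listing, for each state, the exponential clocks running in it as pairs
  (rate, state entered when the clock rings). A clock whose target is the current
  state has no effect, so that the diagonal entries below are minus the total rate of leaving.
\<close>

definition generator :: "('s \<Rightarrow> (real \<times> 's) list) \<Rightarrow> 's \<Rightarrow> 's \<Rightarrow> real" where
  "generator moves x y = (\<Sum>(r, z)\<leftarrow>moves x. r * (of_bool (z = y) - of_bool (x = y)))"

text \<open>
  Transition semigroup on the state space \<open>S\<close> with Q-matrix \<open>q\<close>. Nothing is said about states
  outside \<open>S\<close>. For the chains below the rates are bounded, so that there is exactly one such
  semigroup on \<open>S\<close>.
\<close>

definition transition_semigroup ::
    "'s set \<Rightarrow> ('s \<Rightarrow> 's \<Rightarrow> real) \<Rightarrow> (real \<Rightarrow> 's \<Rightarrow> 's pmf) \<Rightarrow> bool" where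
  "transition_semigroup S q P \<longleftrightarrow>
     (\<forall>x\<in>S. P 0 x = return_pmf x) \<and>
     (\<forall>t\<ge>0. \<forall>x\<in>S. set_pmf (P t x) \<subseteq> S) \<and>
     (\<forall>s\<ge>0. \<forall>t\<ge>0. \<forall>x\<in>S. P (s + t) x = bind_pmf (P s x) (P t)) \<and>
     (\<forall>x\<in>S. \<forall>y\<in>S. ((\<lambda>t. pmf (P t x) y) has_real_derivative q x y) (at 0 within {0..}))"

definition stationary_distribution ::
    "'s set \<Rightarrow> ('s \<Rightarrow> 's \<Rightarrow> real) \<Rightarrow> 's pmf \<Rightarrow> bool" where
  "stationary_distribution S q p \<longleftrightarrow>
     set_pmf p \<subseteq> S \<and>
     (\<exists>P. transition_semigroup S q P \<and> (\<forall>t\<ge>0. bind_pmf p (P t) = p))"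


section \<open>The two-queue k-limited polling model\<close>

text \<open>
  \<open>At1 j\<close> and \<open>At2 j\<close>: the server is serving a customer of the respective queue, and \<open>j\<close> customers
  have already been served in the present visit. As switching takes no time, the server is
  \<open>Idle\<close> only if both queues are empty.
\<close>

datatype server = Idle | At1 nat | At2 nat

type_synonym polling_state = "nat \<times> nat \<times> server"

definition polling_states :: "nat \<Rightarrow> nat \<Rightarrow> polling_state set" where
  "polling_states k1 k2 =
     {(0, 0, Idle)} \<union>
     {(n1, n2, At1 j) | n1 n2 j. 0 < n1 \<and> j < k1} \<union>
     {(n1, n2, At2 j) | n1 n2 j. 0 < n2 \<and> j < k2}"

text \<open>In the next two definitions \<open>n1\<close>, \<open>n2\<close> are the queue lengths after the departure, and \<open>j\<close>
  counts the customers served in the present visit including the departing one.\<close>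

definition after_service1 :: "nat \<Rightarrow> nat \<Rightarrow> nat \<Rightarrow> nat \<Rightarrow> polling_state" where
  "after_service1 k1 n1 n2 j =
     (if 0 < n1 \<and> j < k1 then (n1, n2, At1 j)
      else if 0 < n2 then (n1, n2, At2 0)
      else if 0 < n1 then (n1, n2, At1 0)
      else (n1, n2, Idle))"

definition after_service2 :: "nat \<Rightarrow> nat \<Rightarrow> nat \<Rightarrow> nat \<Rightarrow> polling_state" where
  "after_service2 k2 n1 n2 j =
     (if 0 < n2 \<and> j < k2 then (n1, n2, At2 j)
      else if 0 < n1 then (n1, n2, At1 0)
      else if 0 < n2 then (n1, n2, At2 0)
      else (n1, n2, Idle))"

fun polling_moves ::
    "real \<Rightarrow> real \<Rightarrow> real \<Rightarrow> real \<Rightarrow> nat \<Rightarrow> nat \<Rightarrow> polling_state \<Rightarrow> (real \<times> polling_state) list" where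
  "polling_moves lam1 lam2 mu1 mu2 k1 k2 (n1, n2, Idle) =
     [(lam1, (n1 + 1, n2, At1 0)),
      (lam2, (n1, n2 + 1, At2 0))]"
| "polling_moves lam1 lam2 mu1 mu2 k1 k2 (n1, n2, At1 j) =
     [(lam1, (n1 + 1, n2, At1 j)),
      (lam2, (n1, n2 + 1, At1 j)),
      (mu1, after_service1 k1 (n1 - 1) n2 (j + 1))]"
| "polling_moves lam1 lam2 mu1 mu2 k1 k2 (n1, n2, At2 j) =
     [(lam1, (n1 + 1, n2, At2 j)),
      (lam2, (n1, n2 + 1, At2 j)),
      (mu2, after_service2 k2 n1 (n2 - 1) (j + 1))]"

definition polling_stationary ::
    "real \<Rightarrow> real \<Rightarrow> real \<Rightarrow> real \<Rightarrow> nat \<Rightarrow> nat \<Rightarrow> polling_state pmf \<Rightarrow> bool" where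
  "polling_stationary lam1 lam2 mu1 mu2 k1 k2 p \<longleftrightarrow>
     stationary_distribution (polling_states k1 k2)
       (generator (polling_moves lam1 lam2 mu1 mu2 k1 k2)) p"


section \<open>The k-limited multiple-vacation queue with Erlang vacations\<close>

text \<open>
  An Erlang vacation is run as \<open>k2\<close> successive exponential stages: in \<open>Vacation m\<close>, \<open>m\<close> stages of
  the present vacation are completed. In \<open>Serving j\<close>, \<open>j\<close> customers have already been served in
  the present visit.
\<close>

datatype vserver = Serving nat | Vacation nat

type_synonym vacation_state = "nat \<times> vserver"

definition vacation_states :: "nat \<Rightarrow> nat \<Rightarrow> vacation_state set" where
  "vacation_states k1 k2 =
     {(n, Serving j) | n j. 0 < n \<and> j < k1} \<union>
     {(n, Vacation m) | n m. m < k2}"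

fun vacation_moves ::
    "real \<Rightarrow> real \<Rightarrow> real \<Rightarrow> nat \<Rightarrow> nat \<Rightarrow> vacation_state \<Rightarrow> (real \<times> vacation_state) list" where
  "vacation_moves lam1 mu1 mu2 k1 k2 (n, Serving j) =
     [(lam1, (n + 1, Serving j)),
      (mu1, if 0 < n - 1 \<and> j + 1 < k1 then (n - 1, Serving (j + 1)) else (n - 1, Vacation 0))]"
| "vacation_moves lam1 mu1 mu2 k1 k2 (n, Vacation m) =
     [(lam1, (n + 1, Vacation m)),
      (mu2, if m + 1 < k2 then (n, Vacation (m + 1))
           else if 0 < n then (n, Serving 0)
           else (n, Vacation 0))]"

definition vacation_stationary ::
    "real \<Rightarrow> real \<Rightarrow> real \<Rightarrow> nat \<Rightarrow> nat \<Rightarrow> vacation_state pmf \<Rightarrow> bool" where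
  "vacation_stationary lam1 mu1 mu2 k1 k2 p \<longleftrightarrow>
     stationary_distribution (vacation_states k1 k2)
       (generator (vacation_moves lam1 mu1 mu2 k1 k2)) p"

end

theory Submission
  imports Defs
begin

text \<open>
  Everything about a stationary law is extracted from one identity: the generator, applied to a
  bounded test function, has expectation 0 (\<open>stationary_drift_zero\<close>). Different test
  functions give the different ingredients of the limit.

  The product \<open>(\<mu>\<^sub>1 / (\<mu>\<^sub>1 + \<kappa>))\<^bsup>N\<^sub>1\<^esup> (\<mu>\<^sub>2 / (\<mu>\<^sub>2 + \<kappa>))\<^bsup>N\<^sub>2\<^esup>\<close> is blind to the
  service discipline, because a service at either queue makes it grow at the same relative rate
  \<open>\<kappa>\<close>. It satisfies an exact Pollaczek-Khinchine identity (\<open>transform_idle\<close>):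
  it is the Laplace transform of the workload of a work-conserving single-server system. Letting
  \<open>\<kappa>\<close> tend to 0 shows that the server is idle with probability \<open>\<delta>\<close>. With
  \<open>\<kappa>\<close> of order \<open>\<delta>\<close> it yields the exponential law of \<open>\<delta> N\<^sub>2\<close>, since
  the first queue stays bounded and its contribution disappears (\<open>queue2_laplace\<close>); with
  fixed \<open>\<kappa>\<close> it shows that the second queue is rarely short (\<open>queue2_large\<close>).

  The first queue stays tight uniformly in \<open>\<delta>\<close> by a quadratic Lyapunov function
  (\<open>queue1_tail\<close>). Its linear part adds to \<open>N\<^sub>1\<close> a correction depending on the position in the
  service cycle, so that the drift is negative at every position and not only on average over a
  cycle. This is where the condition \<open>\<lambda>\<^sub>1 / k\<^sub>1 < \<lambda>\<^sub>2 / k\<^sub>2\<close> enters.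

  As long as the second queue holds at least two customers, the first queue and the server move
  exactly like the vacation queue, a visit to the second queue being a vacation. Hence the
  law of the first queue, reweighted by \<open>e\<^bsup>-k \<delta> N\<^sub>2\<^esup>\<close>, is nearly balanced for the
  vacation queue: the weight changes by a factor close to 1 at each step
  (\<open>vacation_drift_small\<close>). A tight family of nearly balanced laws converges to the
  unique stationary law (\<open>nearly_balanced_tendsto\<close>), whatever the weight, and this gives
  the asymptotic independence (\<open>joint_laplace\<close>). Finally the
  expectations of \<open>1{N\<^sub>1 \<le> n} Y\<^sup>k\<close>, where \<open>Y = e\<^bsup>-\<delta> N\<^sub>2\<^esup>\<close> takes values in \<open>[0, 1]\<close>, determine the
  limit of the joint distribution by Weierstrass approximation (\<open>moments_imp_tail\<close>).
\<close>

section \<open>Expectations over probability mass functions\<close>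

lemma integrable_pmf_bounded:
  fixes f :: "'a \<Rightarrow> real"
  assumes "\<And>x. x \<in> set_pmf p \<Longrightarrow> \<bar>f x\<bar> \<le> B"
  shows "integrable (measure_pmf p) f"
  by (rule measure_pmf.integrable_const_bound[where B = B]) (use assms in \<open>auto simp: AE_measure_pmf_iff\<close>)

lemma abs_expectation_le:
  fixes f :: "'a \<Rightarrow> real"
  assumes "\<And>x. x \<in> set_pmf p \<Longrightarrow> \<bar>f x\<bar> \<le> g x" and "integrable (measure_pmf p) g"
  shows "\<bar>measure_pmf.expectation p f\<bar> \<le> measure_pmf.expectation p g"
proof -
  have "\<bar>measure_pmf.expectation p f\<bar> \<le> measure_pmf.expectation p (\<lambda>x. \<bar>f x\<bar>)"
    by (rule integral_abs_bound)
  also have "\<dots> \<le> measure_pmf.expectation p g"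
  proof (rule integral_mono_AE)
    show "integrable (measure_pmf p) (\<lambda>x. \<bar>f x\<bar>)"
      by (rule Bochner_Integration.integrable_bound[OF assms(2)])
         (use assms(1) in \<open>force simp: AE_measure_pmf_iff\<close>)+
  qed (use assms in \<open>auto simp: AE_measure_pmf_iff\<close>)
  finally show ?thesis .
qed

lemma integrable_pmf_indicator [simp]: "integrable (measure_pmf p) (indicator A :: 'a \<Rightarrow> real)"
  by (rule integrable_pmf_bounded[where B = 1]) (auto split: split_indicator)

lemma expectation_finite_approx:
  fixes f :: "'a \<Rightarrow> real"
  assumes "finite A" "\<And>y. \<bar>f y\<bar> \<le> B"
  shows "\<bar>measure_pmf.expectation p f - (\<Sum>y\<in>A. f y * pmf p y)\<bar> \<le> B * (1 - measure_pmf.prob p A)"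
proof -
  have int: "integrable (measure_pmf p) (\<lambda>y. f y * indicator C y)" for C
    by (rule integrable_pmf_bounded[where B = B])
       (use assms(2) in \<open>auto split: split_indicator intro: order_trans[OF abs_ge_zero]\<close>)
  have "measure_pmf.expectation p f
      = measure_pmf.expectation p (\<lambda>y. f y * indicator A y + f y * indicator (- A) y)"
    by (rule Bochner_Integration.integral_cong) (auto split: split_indicator)
  also have "\<dots> = measure_pmf.expectation p (\<lambda>y. f y * indicator A y)
                 + measure_pmf.expectation p (\<lambda>y. f y * indicator (- A) y)"
    by (rule Bochner_Integration.integral_add) (rule int)+
  also have "measure_pmf.expectation p (\<lambda>y. f y * indicator A y) = (\<Sum>y\<in>A. f y * pmf p y)"
    by (subst integral_measure_pmf_real[of A]) (use assms(1) in \<open>auto split: split_indicator_asm\<close>)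
  finally have "measure_pmf.expectation p f - (\<Sum>y\<in>A. f y * pmf p y)
      = measure_pmf.expectation p (\<lambda>y. f y * indicator (- A) y)" by simp
  also have "\<bar>\<dots>\<bar> \<le> measure_pmf.expectation p (\<lambda>y. B * indicator (- A) y)"
    by (rule abs_expectation_le)
       (use assms(2) in \<open>auto simp: abs_mult split: split_indicator\<close>)
  also have "\<dots> = B * (1 - measure_pmf.prob p A)"
    using measure_pmf.prob_compl[of A p] by (simp add: Compl_eq_Diff_UNIV)
  finally show ?thesis .
qed

lemma expectation_bind_pmf:
  fixes f :: "'b \<Rightarrow> real"
  assumes "\<And>y. \<bar>f y\<bar> \<le> B"
  shows "measure_pmf.expectation (bind_pmf p K) f
       = measure_pmf.expectation p (\<lambda>x. measure_pmf.expectation (K x) f)"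
  unfolding measure_pmf_bind
  by (rule integral_bind[where K = "count_space UNIV" and B = B and B' = 1])
     (use assms in \<open>auto simp: measure_pmf.emeasure_space_1 measure_pmf_in_subprob_space\<close>)

text \<open>
  The reweighted law is again a probability mass function, so that statements about such laws
  apply to expectations containing a damping factor \<open>w\<close>.
\<close>
lemma tilted_pmf:
  fixes w :: "'a \<Rightarrow> real"
  assumes w: "\<And>x. 0 \<le> w x" "\<And>x. w x \<le> 1" and mass: "0 < measure_pmf.expectation p w"
  obtains q where "set_pmf q \<subseteq> set_pmf p"
    and "\<And>f :: 'a \<Rightarrow> real. measure_pmf.expectation q f
           = measure_pmf.expectation p (\<lambda>x. f x * w x) / measure_pmf.expectation p w"
proof -
  define c where "c = measure_pmf.expectation p w"
  have c: "0 < c" using mass by (simp add: c_def)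
  define d where "d x = pmf p x * (w x / c)" for x
  have d: "0 \<le> d x" for x using w c by (simp add: d_def)
  have intw: "integrable (measure_pmf p) (\<lambda>x. w x / c)"
    by (rule integrable_pmf_bounded[where B = "1 / c"]) (use w c in \<open>auto simp: divide_right_mono\<close>)
  have "(\<integral>\<^sup>+x. ennreal (d x) \<partial>count_space UNIV) = (\<integral>\<^sup>+x. ennreal (w x / c) \<partial>measure_pmf p)"
    unfolding nn_integral_measure_pmf
    by (rule nn_integral_cong) (use w c in \<open>simp add: d_def flip: ennreal_mult\<close>)
  also have "\<dots> = ennreal (measure_pmf.expectation p (\<lambda>x. w x / c))"
    by (rule nn_integral_eq_integral[OF intw]) (use w c in auto)
  also have "\<dots> = 1" using c by (simp add: c_def)
  finally have total: "(\<integral>\<^sup>+x. ennreal (d x) \<partial>count_space UNIV) = 1" .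
  define q where "q = embed_pmf d"
  have q: "pmf q x = d x" for x unfolding q_def by (rule pmf_embed_pmf[OF d total])
  have "set_pmf q \<subseteq> set_pmf p" by (auto simp: set_pmf_iff q d_def)
  moreover have "measure_pmf.expectation q f = measure_pmf.expectation p (\<lambda>x. f x * w x) / c"
    for f :: "'a \<Rightarrow> real"
  proof -
    have "measure_pmf.expectation q f = (\<integral>x. d x * f x \<partial>count_space UNIV)"
      unfolding measure_pmf_eq_density[of q] by (subst integral_density) (auto simp: q d)
    also have "\<dots> = (\<integral>x. pmf p x * (f x * w x / c) \<partial>count_space UNIV)"
      by (rule Bochner_Integration.integral_cong) (auto simp: d_def)
    also have "\<dots> = measure_pmf.expectation p (\<lambda>x. f x * w x / c)"
      unfolding measure_pmf_eq_density[of p] by (subst integral_density) auto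
    finally show ?thesis by simp
  qed
  ultimately show ?thesis using that[of q] by (simp add: c_def)
qed

section \<open>Generators and stationary distributions\<close>

text \<open>
  The generator as an operator on functions. Summing over the finitely many clocks of \<open>x\<close>, not
  over all states, avoids any question of summability.
\<close>
definition drift :: "('s \<Rightarrow> (real \<times> 's) list) \<Rightarrow> ('s \<Rightarrow> real) \<Rightarrow> 's \<Rightarrow> real" where
  "drift moves f x = (\<Sum>(r, z)\<leftarrow>moves x. r * (f z - f x))"

definition step_rel :: "('s \<Rightarrow> (real \<times> 's) list) \<Rightarrow> ('s \<times> 's) set" where
  "step_rel moves = {(x, z). \<exists>r>0. (r, z) \<in> set (moves x)}"

lemma drift_eq_sum_generator:
  assumes "finite A" "x \<in> A" "snd ` set (moves x) \<subseteq> A"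
  shows "drift moves f x = (\<Sum>y\<in>A. f y * generator moves x y)"
proof -
  have "(\<Sum>(r, z)\<leftarrow>l. r * (f z - f x))
      = (\<Sum>y\<in>A. f y * (\<Sum>(r, z)\<leftarrow>l. r * (of_bool (z = y) - of_bool (x = y))))"
    if "snd ` set l \<subseteq> A" for l
    using that
  proof (induction l)
    case (Cons a l)
    obtain r z where a: "a = (r, z)" by (cases a)
    have "z \<in> A" using Cons.prems a by auto
    have pick: "(\<Sum>y\<in>A. f y * of_bool (w = y)) = f w" if "w \<in> A" for w
    proof -
      have "(\<Sum>y\<in>A. f y * of_bool (w = y)) = (\<Sum>y\<in>A. if w = y then f y else 0)"
        by (rule sum.cong) auto
      then show ?thesis using that assms(1) by simp
    qed
    have "(\<Sum>y\<in>A. f y * (r * (of_bool (z = y) - of_bool (x = y))))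
        = r * ((\<Sum>y\<in>A. f y * of_bool (z = y)) - (\<Sum>y\<in>A. f y * of_bool (x = y)))"
      by (simp add: sum_distrib_left sum_subtractf[symmetric] algebra_simps)
    then show ?case
      using Cons pick[OF \<open>z \<in> A\<close>] pick[OF assms(2)]
      by (simp add: a sum.distrib distrib_left)
  qed simp
  then show ?thesis
    using assms(3) by (simp add: drift_def generator_def)
qed

locale bounded_rate_chain =
  fixes S :: "'s set" and moves :: "'s \<Rightarrow> (real \<times> 's) list" and \<Lambda> :: real
  assumes rate_nonneg: "x \<in> S \<Longrightarrow> (r, z) \<in> set (moves x) \<Longrightarrow> 0 \<le> r"
    and move_in: "x \<in> S \<Longrightarrow> (r, z) \<in> set (moves x) \<Longrightarrow> z \<in> S"
    and total_rate: "x \<in> S \<Longrightarrow> (\<Sum>(r, z)\<leftarrow>moves x. r) \<le> \<Lambda>"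
begin

lemma abs_drift_le:
  assumes "x \<in> S" "\<And>y. \<bar>f y\<bar> \<le> B"
  shows "\<bar>drift moves f x\<bar> \<le> 2 * B * \<Lambda>"
proof -
  have "0 \<le> B" using assms(2)[of x] by linarith
  have le: "r * \<bar>f z - f x\<bar> \<le> r * (2 * B)" if "(r, z) \<in> set (moves x)" for r z
    using rate_nonneg[OF assms(1) that] assms(2)[of z] assms(2)[of x]
    by (intro mult_left_mono) auto
  have "\<bar>drift moves f x\<bar> \<le> (\<Sum>(r, z)\<leftarrow>moves x. \<bar>r * (f z - f x)\<bar>)"
    unfolding drift_def using sum_list_abs[of "map (\<lambda>(r, z). r * (f z - f x)) (moves x)"]
    by (simp add: o_def case_prod_unfold)
  also have "\<dots> \<le> (\<Sum>(r, z)\<leftarrow>moves x. r * (2 * B))"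
    by (rule sum_list_mono) (use le rate_nonneg[OF assms(1)] in \<open>auto simp: abs_mult\<close>)
  also have "\<dots> = (\<Sum>(r, z)\<leftarrow>moves x. r) * (2 * B)"
    by (simp add: case_prod_unfold sum_list_mult_const)
  also have "\<dots> \<le> \<Lambda> * (2 * B)"
    using total_rate[OF assms(1)] \<open>0 \<le> B\<close> by (intro mult_right_mono) auto
  finally show ?thesis by (simp add: mult_ac)
qed

lemma generator_diag_ge:
  assumes "x \<in> S"
  shows "- \<Lambda> \<le> generator moves x x"
proof -
  have "(\<Sum>(r, z)\<leftarrow>moves x. - r) \<le> generator moves x x"
    unfolding generator_def
    by (rule sum_list_mono) (use rate_nonneg[OF assms] in auto)
  moreover have "(\<Sum>(r, z)\<leftarrow>moves x. - r) = - (\<Sum>(r, z)\<leftarrow>moves x. r)"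
    by (simp add: uminus_sum_list_map o_def case_prod_unfold)
  ultimately show ?thesis using total_rate[OF assms] by linarith
qed

context
  fixes P
  assumes semigroup: "transition_semigroup S (generator moves) P"
begin

lemma semigroup_stay_mult:
  assumes "x \<in> S" "0 \<le> s" "0 \<le> t"
  shows "pmf (P s x) x * pmf (P t x) x \<le> pmf (P (s + t) x) x"
proof -
  have "pmf (P s x) x * pmf (P t x) x
      = measure_pmf.expectation (P s x) (\<lambda>y. indicator {x} y * pmf (P t x) x)"
    by (simp add: measure_pmf_single)
  also have "\<dots> \<le> measure_pmf.expectation (P s x) (\<lambda>y. pmf (P t y) x)"
    by (intro integral_mono integrable_pmf_bounded[where B = 1])
       (auto simp: pmf_le_1 split: split_indicator)
  also have "\<dots> = pmf (P (s + t) x) x"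
    using semigroup assms by (simp add: transition_semigroup_def pmf_bind)
  finally show ?thesis .
qed

lemma semigroup_stay_power:
  assumes "x \<in> S" "0 \<le> h"
  shows "pmf (P h x) x ^ n \<le> pmf (P (real n * h) x) x"
proof (induction n)
  case 0
  then show ?case using semigroup assms by (simp add: transition_semigroup_def)
next
  case (Suc n)
  have "pmf (P h x) x ^ Suc n \<le> pmf (P h x) x * pmf (P (real n * h) x) x"
    using Suc by (simp add: mult_left_mono)
  also have "\<dots> \<le> pmf (P (h + real n * h) x) x"
    using assms by (intro semigroup_stay_mult) auto
  finally show ?case by (simp add: distrib_right)
qed

lemma semigroup_difference_quotient:
  assumes "x \<in> S" "y \<in> S" "\<And>n. 0 < h n" "h \<longlonglongrightarrow> 0"
  shows "(\<lambda>n. (pmf (P (h n) x) y - of_bool (x = y)) / h n) \<longlonglongrightarrow> generator moves x y"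
proof -
  have "((\<lambda>t. pmf (P t x) y) has_real_derivative generator moves x y) (at 0 within {0..})"
    using semigroup assms by (simp add: transition_semigroup_def)
  then have "((\<lambda>t. (pmf (P t x) y - pmf (P 0 x) y) / (t - 0)) \<longlongrightarrow> generator moves x y)
               (at 0 within {0..})"
    by (simp add: has_field_derivative_iff)
  moreover have "filterlim h (at 0 within {0..}) sequentially"
    unfolding filterlim_at using assms(4) less_imp_le[OF assms(3)] less_imp_neq[OF assms(3)]
    by (auto intro!: always_eventually)
  moreover have "pmf (P 0 x) y = of_bool (x = y)"
    using semigroup assms by (simp add: transition_semigroup_def indicator_def)
  ultimately show ?thesis
    by (auto dest: filterlim_compose)
qed

text \<open>
  Bernoulli's inequality, applied to \<open>n\<close> steps of length \<open>t / n\<close>, turns the derivative at 0 into a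
  bound that is uniform in the state. The uniformity provides the dominating function
  needed to differentiate under a stationary law.
\<close>
lemma semigroup_leave_le:
  assumes "x \<in> S" "0 \<le> t"
  shows "1 - pmf (P t x) x \<le> \<Lambda> * t"
proof (cases "t = 0")
  case True
  then show ?thesis using semigroup assms by (simp add: transition_semigroup_def)
next
  case False
  with assms have "0 < t" by simp
  define h where "h n = t / real (Suc n)" for n
  have h: "0 < h n" for n using \<open>0 < t\<close> by (simp add: h_def)
  have "h \<longlonglongrightarrow> 0"
    unfolding h_def using tendsto_mult[OF tendsto_const LIMSEQ_inverse_real_of_nat, of t]
    by (simp add: divide_inverse)
  have "(\<lambda>n. (pmf (P (h n) x) x - of_bool (x = x)) / h n) \<longlonglongrightarrow> generator moves x x"
    by (rule semigroup_difference_quotient) (use assms h \<open>h \<longlonglongrightarrow> 0\<close> in auto)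
  then have lim: "(\<lambda>n. 1 + t * ((pmf (P (h n) x) x - 1) / h n)) \<longlonglongrightarrow> 1 + t * generator moves x x"
    by (intro tendsto_intros) simp
  have "1 + t * ((pmf (P (h n) x) x - 1) / h n) \<le> pmf (P t x) x" for n
  proof -
    have "1 + t * ((pmf (P (h n) x) x - 1) / h n) = 1 + real (Suc n) * (pmf (P (h n) x) x - 1)"
      using \<open>0 < t\<close> by (simp add: h_def field_simps)
    also have "\<dots> \<le> (1 + (pmf (P (h n) x) x - 1)) ^ Suc n"
      by (rule Bernoulli_inequality) simp
    also have "\<dots> \<le> pmf (P (real (Suc n) * h n) x) x"
      using semigroup_stay_power[OF assms(1), of "h n" "Suc n"] h[of n] by simp
    also have "real (Suc n) * h n = t" by (simp add: h_def)
    finally show ?thesis .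
  qed
  then have "1 + t * generator moves x x \<le> pmf (P t x) x"
    by (intro LIMSEQ_le_const2[OF lim]) auto
  moreover have "t * - \<Lambda> \<le> t * generator moves x x"
    using generator_diag_ge[OF assms(1)] assms(2) by (rule mult_left_mono)
  ultimately show ?thesis by (simp add: mult.commute)
qed

text \<open>
  Only finitely many states can be reached by one clock, and on them the quotient
  converges term by term. The remaining mass is \<open>o(t)\<close> because the rows of the Q-matrix sum to 0,
  so that a bounded function sees nothing of it.
\<close>
lemma semigroup_expectation_quotient:
  assumes "x \<in> S" "\<And>y. \<bar>f y\<bar> \<le> B" "\<And>n. 0 < h n" "h \<longlonglongrightarrow> 0"
  shows "(\<lambda>n. (measure_pmf.expectation (P (h n) x) f - f x) / h n) \<longlonglongrightarrow> drift moves f x"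
proof -
  define A where "A = insert x (snd ` set (moves x))"
  have A: "finite A" "x \<in> A" "snd ` set (moves x) \<subseteq> A" "A \<subseteq> S"
    using move_in[OF assms(1)] assms(1) by (auto simp: A_def)
  define D where "D n y = (pmf (P (h n) x) y - of_bool (x = y)) / h n" for n y
  have D: "(\<lambda>n. D n y) \<longlonglongrightarrow> generator moves x y" if "y \<in> A" for y
    unfolding D_def by (rule semigroup_difference_quotient) (use that A assms in auto)
  have pick: "(\<Sum>y\<in>A. g y * of_bool (x = y)) = g x" for g :: "_ \<Rightarrow> real"
  proof -
    have "(\<Sum>y\<in>A. g y * of_bool (x = y)) = (\<Sum>y\<in>A. if x = y then g y else 0)"
      by (rule sum.cong) auto
    then show ?thesis using A by simp
  qed
  have main: "(\<lambda>n. \<Sum>y\<in>A. f y * D n y) \<longlonglongrightarrow> drift moves f x"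
    unfolding drift_eq_sum_generator[where moves = moves, OF A(1) A(2) A(3)]
    by (intro tendsto_sum tendsto_mult_left D)
  have "(\<lambda>n. \<Sum>y\<in>A. 1 * D n y) \<longlonglongrightarrow> drift moves (\<lambda>_. 1) x"
    unfolding drift_eq_sum_generator[where moves = moves, OF A(1) A(2) A(3)]
    by (intro tendsto_sum tendsto_mult_left D)
  then have mass: "(\<lambda>n. - B * (\<Sum>y\<in>A. D n y)) \<longlonglongrightarrow> 0"
    using tendsto_mult_left[of _ 0 sequentially "- B"] by (simp add: drift_def case_prod_unfold)
  have "\<bar>(measure_pmf.expectation (P (h n) x) f - f x) / h n - (\<Sum>y\<in>A. f y * D n y)\<bar>
      \<le> - B * (\<Sum>y\<in>A. D n y)" for n
  proof -
    let ?Q = "P (h n) x"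
    have eq: "(measure_pmf.expectation ?Q f - f x) / h n - (\<Sum>y\<in>A. f y * D n y)
        = (measure_pmf.expectation ?Q f - (\<Sum>y\<in>A. f y * pmf ?Q y)) / h n"
    proof -
      have "(\<Sum>y\<in>A. f y * D n y) = (\<Sum>y\<in>A. f y * (pmf ?Q y - of_bool (x = y))) / h n"
        by (simp add: D_def sum_divide_distrib)
      also have "\<dots> = ((\<Sum>y\<in>A. f y * pmf ?Q y) - f x) / h n"
        using pick[of f] by (simp add: right_diff_distrib sum_subtractf)
      finally show ?thesis by (simp add: diff_divide_distrib)
    qed
    have "\<bar>measure_pmf.expectation ?Q f - (\<Sum>y\<in>A. f y * pmf ?Q y)\<bar>
        \<le> B * (1 - measure_pmf.prob ?Q A)"
      by (rule expectation_finite_approx) (use A(1) assms(2) in auto)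
    also have "\<dots> = B * (1 - (\<Sum>y\<in>A. pmf ?Q y))"
      using A(1) by (simp add: measure_measure_pmf_finite)
    also have "\<dots> = - B * (\<Sum>y\<in>A. (pmf ?Q y - of_bool (x = y)))"
      using pick[of "\<lambda>_. 1"] by (simp add: sum_subtractf algebra_simps)
    also have "\<dots> = (- B * (\<Sum>y\<in>A. D n y)) * h n"
      using assms(3)[of n] by (simp add: D_def sum_divide_distrib[symmetric])
    finally show ?thesis
      unfolding eq using assms(3)[of n] by (simp add: abs_divide pos_divide_le_eq)
  qed
  then have "(\<lambda>n. (measure_pmf.expectation (P (h n) x) f - f x) / h n - (\<Sum>y\<in>A. f y * D n y))
               \<longlonglongrightarrow> 0"
    by (intro Lim_null_comparison[OF _ mass] always_eventually) simp
  from tendsto_add[OF this main] show ?thesis by simp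
qed

lemma semigroup_expectation_lipschitz:
  assumes "x \<in> S" "\<And>y. \<bar>f y\<bar> \<le> B" "0 \<le> t"
  shows "\<bar>measure_pmf.expectation (P t x) f - f x\<bar> \<le> 2 * B * (\<Lambda> * t)"
proof -
  let ?Q = "P t x"
  have "0 \<le> B" using assms(2)[of x] by linarith
  have "measure_pmf.expectation ?Q f - f x = measure_pmf.expectation ?Q (\<lambda>y. f y - f x)"
    by (subst Bochner_Integration.integral_diff)
       (use assms(2) in \<open>auto intro: integrable_pmf_bounded\<close>)
  also have "\<bar>\<dots>\<bar> \<le> measure_pmf.expectation ?Q (\<lambda>y. 2 * B * indicator (- {x}) y)"
  proof (rule abs_expectation_le)
    show "\<bar>f y - f x\<bar> \<le> 2 * B * indicator (- {x}) y" for y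
      using assms(2)[of y] assms(2)[of x] by (auto split: split_indicator)
    show "integrable (measure_pmf ?Q) (\<lambda>y. 2 * B * indicator (- {x}) y)"
      by (rule integrable_pmf_bounded[where B = "2 * B"])
         (use \<open>0 \<le> B\<close> in \<open>auto split: split_indicator\<close>)
  qed
  also have "\<dots> = 2 * B * (1 - pmf ?Q x)"
    using measure_pmf.prob_compl[of "{x}" ?Q]
    by (simp add: measure_pmf_single Compl_eq_Diff_UNIV)
  also have "\<dots> \<le> 2 * B * (\<Lambda> * t)"
    using semigroup_leave_le[OF assms(1,3)] \<open>0 \<le> B\<close> by (intro mult_left_mono) auto
  finally show ?thesis .
qed

end

text \<open>
  The derivative at time 0 of the constant function that maps \<open>t\<close> to the expectation of
  \<open>f(X\<^sub>t)\<close>.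
\<close>
lemma stationary_drift_zero:
  assumes "stationary_distribution S (generator moves) p" and bounded: "\<And>x. \<bar>f x\<bar> \<le> B"
  shows "measure_pmf.expectation p (drift moves f) = 0"
proof -
  from assms(1) obtain P where pS: "set_pmf p \<subseteq> S"
    and P: "transition_semigroup S (generator moves) P" and inv: "\<And>t. t \<ge> 0 \<Longrightarrow> bind_pmf p (P t) = p"
    by (auto simp: stationary_distribution_def)
  define h where "h n = inverse (real (Suc n))" for n
  have h: "0 < h n" for n by (simp add: h_def)
  have "h \<longlonglongrightarrow> 0" unfolding h_def by (rule LIMSEQ_inverse_real_of_nat)
  let ?s = "\<lambda>n x. (measure_pmf.expectation (P (h n) x) f - f x) / h n"
  have "(\<lambda>n. measure_pmf.expectation p (?s n)) \<longlonglongrightarrow> measure_pmf.expectation p (drift moves f)"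
  proof (rule integral_dominated_convergence[where w = "\<lambda>_. 2 * B * \<Lambda>"])
    show "AE x in measure_pmf p. (\<lambda>n. ?s n x) \<longlonglongrightarrow> drift moves f x"
      using pS semigroup_expectation_quotient[where f = f, OF P _ bounded h \<open>h \<longlonglongrightarrow> 0\<close>]
      by (auto simp: AE_measure_pmf_iff)
    show "AE x in measure_pmf p. norm (?s n x) \<le> 2 * B * \<Lambda>" for n
    proof (unfold AE_measure_pmf_iff, intro ballI)
      fix x assume "x \<in> set_pmf p"
      then have "\<bar>measure_pmf.expectation (P (h n) x) f - f x\<bar> \<le> 2 * B * (\<Lambda> * h n)"
        using pS h[of n] by (intro semigroup_expectation_lipschitz[OF P _ bounded]) auto
      then show "norm (?s n x) \<le> 2 * B * \<Lambda>"
        using h[of n] by (simp add: abs_divide pos_divide_le_eq mult_ac)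
    qed
  qed auto
  moreover have "measure_pmf.expectation p (?s n) = 0" for n
  proof -
    have le: "\<bar>measure_pmf.expectation (P (h n) x) f\<bar> \<le> B" for x
      using abs_expectation_le[of "P (h n) x" f "\<lambda>_. B"] bounded by simp
    have "measure_pmf.expectation p (?s n)
        = (measure_pmf.expectation p (\<lambda>x. measure_pmf.expectation (P (h n) x) f)
           - measure_pmf.expectation p f) / h n"
      by (subst Bochner_Integration.integral_diff[symmetric])
         (use bounded le in \<open>auto intro!: integrable_pmf_bounded\<close>)
    also have "\<dots> = 0"
      using expectation_bind_pmf[where f = f and B = B and p = p and K = "P (h n)", OF bounded]
        inv[of "h n"] h[of n] by simp
    finally show ?thesis .
  qed
  ultimately show ?thesis by (simp only: LIMSEQ_const_iff)
qed

end

section \<open>Convergence to the unique stationary distribution\<close>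

text \<open>
  Tightness prevents mass from escaping, so that a pointwise limit of mass functions has mass 1 and
  pointwise convergence extends to expectations of bounded functions.
\<close>
lemma tight_pmf_limit:
  fixes m :: "'i \<Rightarrow> 's pmf" and M :: "'s \<Rightarrow> real"
  assumes F: "F \<noteq> bot"
    and tight: "\<And>\<epsilon>. 0 < \<epsilon> \<Longrightarrow> \<exists>A. finite A \<and> (\<forall>\<^sub>F i in F. 1 - \<epsilon> \<le> measure_pmf.prob (m i) A)"
    and lim: "\<And>x. ((\<lambda>i. pmf (m i) x) \<longlongrightarrow> M x) F"
  obtains q where "\<And>x. pmf q x = M x"
    and "\<And>(h :: 's \<Rightarrow> real) B. (\<And>x. \<bar>h x\<bar> \<le> B) \<Longrightarrow>
           ((\<lambda>i. measure_pmf.expectation (m i) h) \<longlongrightarrow> measure_pmf.expectation q h) F"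
proof -
  have nonneg: "0 \<le> M x" for x
    by (rule tendsto_lowerbound[OF lim _ F]) simp
  have lim_prob: "((\<lambda>i. measure_pmf.prob (m i) A) \<longlongrightarrow> sum M A) F" if "finite A" for A
    using that by (simp add: measure_measure_pmf_finite lim tendsto_sum)
  have le_1: "sum M A \<le> 1" if "finite A" for A
    by (rule tendsto_upperbound[OF lim_prob[OF that] _ F]) simp
  have ge: "1 - \<epsilon> \<le> sum M A"
    if "finite A" "\<forall>\<^sub>F i in F. 1 - \<epsilon> \<le> measure_pmf.prob (m i) A" for A \<epsilon>
    by (rule tendsto_lowerbound[OF lim_prob[OF that(1)] that(2) F])
  have summable: "M summable_on UNIV"
    by (rule nonneg_bdd_above_summable_on) (use nonneg le_1 in \<open>auto intro!: bdd_aboveI\<close>)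
  have "infsum M UNIV \<le> 1"
    by (rule infsum_le_finite_sums[OF summable]) (use le_1 in auto)
  moreover have "1 \<le> infsum M UNIV"
  proof (rule field_le_epsilon)
    fix \<epsilon> :: real assume "0 < \<epsilon>"
    from tight[OF this] obtain A where A: "finite A" "1 - \<epsilon> \<le> sum M A" using ge by blast
    have "sum M A \<le> infsum M UNIV"
      by (rule finite_sum_le_infsum[OF summable]) (use A nonneg in auto)
    with A show "1 \<le> infsum M UNIV + \<epsilon>" by linarith
  qed
  ultimately have sum1: "infsum M UNIV = 1" by simp
  have abs: "Infinite_Set_Sum.abs_summable_on M UNIV"
    using iffD1[OF summable_on_iff_abs_summable_on_real summable] by (simp only: abs_summable_equivalent)
  have "(\<integral>\<^sup>+x. ennreal (M x) \<partial>count_space UNIV) = ennreal (infsetsum M UNIV)"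
    by (rule nn_integral_conv_infsetsum) (use abs nonneg in auto)
  then have mass: "(\<integral>\<^sup>+x. ennreal (M x) \<partial>count_space UNIV) = 1"
    using infsetsum_infsum[OF abs] sum1 by simp
  define q where "q = embed_pmf M"
  have q: "pmf q x = M x" for x
    unfolding q_def by (rule pmf_embed_pmf) (use nonneg mass in auto)
  have "((\<lambda>i. measure_pmf.expectation (m i) h) \<longlongrightarrow> measure_pmf.expectation q h) F"
    if h: "\<And>x. \<bar>h x\<bar> \<le> B" for h :: "'s \<Rightarrow> real" and B
  proof (rule tendstoI)
    fix e :: real assume "0 < e"
    have "0 \<le> B" using h[of undefined] by linarith
    define \<epsilon> where "\<epsilon> = e / (4 * (B + 1))"
    have "0 < \<epsilon>" using \<open>0 < e\<close> \<open>0 \<le> B\<close> by (simp add: \<epsilon>_def)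
    have B\<epsilon>: "B * \<epsilon> \<le> e / 4"
      using \<open>0 < e\<close> \<open>0 \<le> B\<close> by (simp add: \<epsilon>_def field_simps)
    from tight[OF \<open>0 < \<epsilon>\<close>] obtain A where A: "finite A"
      and mA: "\<forall>\<^sub>F i in F. 1 - \<epsilon> \<le> measure_pmf.prob (m i) A" by blast
    have close: "\<bar>measure_pmf.expectation p h - (\<Sum>x\<in>A. h x * pmf p x)\<bar> \<le> e / 4"
      if "1 - \<epsilon> \<le> measure_pmf.prob p A" for p
    proof -
      have "B * (1 - measure_pmf.prob p A) \<le> B * \<epsilon>"
        using that \<open>0 \<le> B\<close> by (intro mult_left_mono) auto
      with expectation_finite_approx[where f = h and p = p, OF A h] B\<epsilon> show ?thesis by linarith
    qed
    have "measure_pmf.prob q A = sum M A" using A by (simp add: measure_measure_pmf_finite q)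
    with ge[OF A mA] have closeq: "\<bar>measure_pmf.expectation q h - (\<Sum>x\<in>A. h x * M x)\<bar> \<le> e / 4"
      using close[of q] by (simp add: q)
    have "((\<lambda>i. \<Sum>x\<in>A. h x * pmf (m i) x) \<longlongrightarrow> (\<Sum>x\<in>A. h x * M x)) F"
      by (intro tendsto_intros lim)
    then have "\<forall>\<^sub>F i in F. dist (\<Sum>x\<in>A. h x * pmf (m i) x) (\<Sum>x\<in>A. h x * M x) < e / 4"
      using \<open>0 < e\<close> by (intro tendstoD) auto
    with mA show "\<forall>\<^sub>F i in F. dist (measure_pmf.expectation (m i) h) (measure_pmf.expectation q h) < e"
    proof eventually_elim
      case (elim i)
      from close[OF elim(1)] elim(2) closeq \<open>0 < e\<close> show ?case
        by (simp add: dist_real_def abs_if split: if_splits)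
    qed
  qed
  with q show ?thesis by (rule that)
qed

text \<open>
  Tychonoff's theorem for the cube \<open>[0, 1]\<^bsup>S\<^esup>\<close>. Refining the filter instead of choosing a
  subsequence avoids a diagonal argument and any enumeration of the states.
\<close>
lemma pointwise_cluster_point:
  fixes g :: "'i \<Rightarrow> 's \<Rightarrow> real"
  assumes F: "F \<noteq> bot" and bounds: "\<And>i x. 0 \<le> g i x \<and> g i x \<le> 1"
  obtains F' M where "F' \<noteq> bot" "F' \<le> F" "\<And>x. ((\<lambda>i. g i x) \<longlongrightarrow> M x) F'"
proof -
  let ?K = "PiE UNIV (\<lambda>_. {0..1::real}) :: ('s \<Rightarrow> real) set"
  have "compactin (product_topology (\<lambda>_. euclidean) UNIV) ?K"
    by (subst compactin_PiE) simp
  then have "compact ?K"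
    by (simp add: euclidean_product_topology)
  moreover have "filtermap g F \<noteq> bot" using F by (simp add: filtermap_bot_iff)
  moreover have "\<forall>\<^sub>F y in filtermap g F. y \<in> ?K"
    using bounds by (auto simp: eventually_filtermap intro!: always_eventually)
  ultimately obtain M where M: "inf (nhds M) (filtermap g F) \<noteq> bot"
    unfolding compact_filter by blast
  define F' where "F' = inf F (filtercomap g (nhds M))"
  have "F' \<noteq> bot"
  proof
    assume "F' = bot"
    then have "eventually (\<lambda>_. False) F'" by simp
    then obtain P Q where P: "eventually P F" and Q: "eventually Q (filtercomap g (nhds M))"
      and PQ: "\<And>i. P i \<Longrightarrow> Q i \<Longrightarrow> False"
      unfolding F'_def eventually_inf by blast
    from Q obtain R where R: "eventually R (nhds M)" "\<And>i. R (g i) \<Longrightarrow> Q i"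
      unfolding eventually_filtercomap by blast
    have "eventually (\<lambda>y. \<not> R y) (filtermap g F)"
      unfolding eventually_filtermap by (rule eventually_mono[OF P]) (use PQ R(2) in blast)
    with R(1) have "eventually (\<lambda>_. False) (inf (nhds M) (filtermap g F))"
      unfolding eventually_inf by blast
    with M show False by (simp add: eventually_False)
  qed
  moreover have "F' \<le> F" by (simp add: F'_def)
  moreover have "((\<lambda>i. g i x) \<longlongrightarrow> M x) F'" for x
  proof -
    have lim: "(g \<longlongrightarrow> M) F'"
      unfolding F'_def by (rule filterlim_mono[OF filterlim_filtercomap]) auto
    have cont: "continuous_on UNIV (\<lambda>f :: 's \<Rightarrow> real. f x)"
      by (rule continuous_on_product_coordinates)
    show ?thesis
      by (rule continuous_on_tendsto_compose[OF cont lim]) simp_all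
  qed
  ultimately show ?thesis by (rule that)
qed

context bounded_rate_chain
begin

text \<open>
  Test with the indicator of the set \<open>E\<close> on which \<open>p\<close> exceeds \<open>q\<close>. Its drift is nonpositive on \<open>E\<close>
  and nonnegative off \<open>E\<close>, so that every term of the sum of \<open>(q - p)\<close> times the drift is
  nonnegative. The sum being 0, each term vanishes, and hence no positive rate leads out of \<open>E\<close>.
\<close>
lemma excess_set_closed:
  fixes p q
  defines "E \<equiv> {x. pmf q x < pmf p x}"
  assumes supp: "set_pmf p \<subseteq> S" "set_pmf q \<subseteq> S"
    and drift: "measure_pmf.expectation p (drift moves (indicator E)) = 0"
      "measure_pmf.expectation q (drift moves (indicator E)) = 0"
    and x: "x \<in> E" "(x, z) \<in> step_rel moves"
  shows "z \<in> E"
proof (rule ccontr)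
  assume "z \<notin> E"
  let ?d = "drift moves (indicator E)"
  have ES: "E \<subseteq> S"
  proof
    fix y assume "y \<in> E"
    then have "0 < pmf p y" using pmf_nonneg[of q y] by (simp add: E_def del: pmf_nonneg)
    then show "y \<in> S" using supp by (auto simp: set_pmf_iff)
  qed
  have out: "?d y \<le> 0" if "y \<in> E" for y
    unfolding drift_def
    by (rule sum_list_nonpos)
       (use that ES rate_nonneg[of y] in \<open>auto intro!: mult_nonneg_nonpos split: split_indicator\<close>)
  have into: "0 \<le> ?d y" if "y \<in> S" "y \<notin> E" for y
    unfolding drift_def
    by (rule sum_list_nonneg) (use that rate_nonneg[of y] in auto)
  have int: "integrable (measure_pmf r) ?d" if "set_pmf r \<subseteq> S" for r
    by (rule integrable_pmf_bounded[where B = "2 * 1 * \<Lambda>"], rule abs_drift_le)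
       (use that in \<open>auto split: split_indicator\<close>)
  have intc: "integrable (count_space UNIV) (\<lambda>y. pmf r y * ?d y)" if "set_pmf r \<subseteq> S" for r
    using int[OF that] unfolding measure_pmf_eq_density by (subst (asm) integrable_density) auto
  have expc: "measure_pmf.expectation r ?d = (\<integral>y. pmf r y * ?d y \<partial>count_space UNIV)" for r
    unfolding measure_pmf_eq_density by (subst integral_density) auto
  let ?\<sigma> = "\<lambda>y. pmf q y * ?d y - pmf p y * ?d y"
  have "0 \<le> ?\<sigma> y" for y
  proof (cases "y \<in> S")
    case True
    then show ?thesis using out[of y] into[of y]
      by (cases "y \<in> E") (auto simp: E_def mult_right_mono mult_right_mono_neg)
  next
    case False
    then have "pmf p y = 0" "pmf q y = 0" using supp by (auto simp: pmf_eq_0_set_pmf)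
    then show ?thesis by simp
  qed
  moreover have "(\<integral>y. ?\<sigma> y \<partial>count_space UNIV) = 0"
    using drift by (simp add: intc[OF supp(1)] intc[OF supp(2)] expc)
  ultimately have "AE y in count_space UNIV. ?\<sigma> y = 0"
    by (subst (asm) integral_nonneg_eq_0_iff_AE) (auto intro!: Bochner_Integration.integrable_diff intc supp)
  then have "?\<sigma> x = 0" by (simp add: AE_count_space)
  moreover have "?d x < 0"
  proof -
    obtain r where r: "0 < r" "(r, z) \<in> set (moves x)" using x(2) by (auto simp: step_rel_def)
    then obtain l1 l2 where l: "moves x = l1 @ (r, z) # l2" by (meson split_list)
    have le: "(\<Sum>(r, z)\<leftarrow>l. r * (indicator E z - indicator E x)) \<le> (0::real)"
      if "set l \<subseteq> set (moves x)" for l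
      by (rule sum_list_nonpos)
         (use that x(1) ES rate_nonneg[of x] in \<open>auto intro!: mult_nonneg_nonpos split: split_indicator\<close>)
    have "set l1 \<subseteq> set (moves x)" "set l2 \<subseteq> set (moves x)" by (auto simp: l)
    from le[OF this(1)] le[OF this(2)] show ?thesis
      using r(1) x(1) \<open>z \<notin> E\<close> by (simp add: drift_def l)
  qed
  ultimately show False using x(1) by (auto simp: E_def)
qed

text \<open>
  If \<open>p\<close> and \<open>q\<close> differ, each of them exceeds the other somewhere. Both excess sets are closed under
  transitions, so that both would contain the state \<open>c\<close>.
\<close>
lemma balanced_unique:
  assumes supp: "set_pmf p \<subseteq> S" "set_pmf q \<subseteq> S"
    and drift: "\<And>f B. (\<And>x. \<bar>f x\<bar> \<le> B) \<Longrightarrow> measure_pmf.expectation p (drift moves f) = 0"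
      "\<And>f B. (\<And>x. \<bar>f x\<bar> \<le> B) \<Longrightarrow> measure_pmf.expectation q (drift moves f) = 0"
    and reach: "\<And>x. x \<in> S \<Longrightarrow> (x, c) \<in> (step_rel moves)\<^sup>*"
  shows "p = q"
proof (rule ccontr)
  have *: "pmf r' c < pmf r c"
    if r: "set_pmf r \<subseteq> S" "set_pmf r' \<subseteq> S"
      "\<And>E. measure_pmf.expectation r (drift moves (indicator E)) = 0"
      "\<And>E. measure_pmf.expectation r' (drift moves (indicator E)) = 0"
      and less: "pmf r' x < pmf r x" for r r' x
  proof -
    have "0 < pmf r x" using less pmf_nonneg[of r' x] by linarith
    then have "x \<in> S" using r(1) by (auto simp: set_pmf_iff)
    from reach[OF this] less show ?thesis
    proof (induction rule: converse_rtrancl_induct)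
      case (step y z)
      have "z \<in> {x. pmf r' x < pmf r x}"
        by (rule excess_set_closed[OF r(1,2)]) (use r(3,4) step in auto)
      then show ?case using step by simp
    qed
  qed
  have ind: "\<bar>indicator E x :: real\<bar> \<le> 1" for E x by (auto split: split_indicator)
  note zero = drift(1)[OF ind] drift(2)[OF ind]
  assume "p \<noteq> q"
  from pmf_neq_exists_less[OF this] pmf_neq_exists_less[OF this[symmetric]]
  show False
    using *[OF supp zero] *[OF supp(2,1) zero(2,1)] by (meson less_asym)
qed

text \<open>
  Compactness and uniqueness combined: any cluster point of the family is balanced and therefore
  equal to \<open>v\<close>.
\<close>
theorem nearly_balanced_tendsto:
  fixes m :: "'i \<Rightarrow> 's pmf" and h :: "'s \<Rightarrow> real"
  assumes supp: "\<And>i. set_pmf (m i) \<subseteq> S"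
    and tight: "\<And>\<epsilon>. 0 < \<epsilon> \<Longrightarrow> \<exists>A. finite A \<and> (\<forall>\<^sub>F i in F. 1 - \<epsilon> \<le> measure_pmf.prob (m i) A)"
    and near: "\<And>f B. (\<And>x. \<bar>f x\<bar> \<le> B) \<Longrightarrow>
                 ((\<lambda>i. measure_pmf.expectation (m i) (drift moves f)) \<longlongrightarrow> 0) F"
    and v: "set_pmf v \<subseteq> S"
      "\<And>f B. (\<And>x. \<bar>f x\<bar> \<le> B) \<Longrightarrow> measure_pmf.expectation v (drift moves f) = 0"
    and reach: "\<And>x. x \<in> S \<Longrightarrow> (x, c) \<in> (step_rel moves)\<^sup>*"
    and h: "\<And>x. \<bar>h x\<bar> \<le> B"
  shows "((\<lambda>i. measure_pmf.expectation (m i) h) \<longlongrightarrow> measure_pmf.expectation v h) F"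
proof (rule tendstoI, rule ccontr)
  fix e :: real
  let ?near = "\<lambda>i. dist (measure_pmf.expectation (m i) h) (measure_pmf.expectation v h) < e"
  assume "0 < e" and "\<not> eventually ?near F"
  define F1 where "F1 = inf F (principal {i. \<not> ?near i})"
  have "F1 \<noteq> bot"
    using \<open>\<not> eventually ?near F\<close> unfolding F1_def trivial_limit_def eventually_inf_principal by simp
  then obtain F' M where F': "F' \<noteq> bot" "F' \<le> F1" and M: "\<And>x. ((\<lambda>i. pmf (m i) x) \<longlongrightarrow> M x) F'"
    using pointwise_cluster_point[of F1 "\<lambda>i. pmf (m i)"] by (auto simp: pmf_le_1)
  have "F' \<le> F" using F'(2) by (simp add: F1_def)
  have tight': "\<exists>A. finite A \<and> (\<forall>\<^sub>F i in F'. 1 - \<epsilon> \<le> measure_pmf.prob (m i) A)" if "0 < \<epsilon>" for \<epsilon>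
    using tight[OF that] filter_leD[OF \<open>F' \<le> F\<close>] by blast
  obtain q where q: "\<And>x. pmf q x = M x"
    and conv: "\<And>(h :: 's \<Rightarrow> real) B. (\<And>x. \<bar>h x\<bar> \<le> B) \<Longrightarrow>
           ((\<lambda>i. measure_pmf.expectation (m i) h) \<longlongrightarrow> measure_pmf.expectation q h) F'"
    using tight_pmf_limit[OF F'(1) tight' M] by blast
  have qS: "set_pmf q \<subseteq> S"
  proof
    fix x assume "x \<in> set_pmf q"
    show "x \<in> S"
    proof (rule ccontr)
      assume "x \<notin> S"
      then have "pmf (m i) x = 0" for i using supp[of i] by (auto simp: pmf_eq_0_set_pmf)
      then have "M x = 0" using M[of x] F'(1) by (simp add: tendsto_const_iff)
      then show False using \<open>x \<in> set_pmf q\<close> by (simp add: set_pmf_iff q)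
    qed
  qed
  have qz: "measure_pmf.expectation q (drift moves f) = 0" if f: "\<And>x. \<bar>f x\<bar> \<le> C" for f C
  proof -
    let ?g = "\<lambda>x. drift moves f x * indicator S x"
    have on_S: "measure_pmf.expectation r ?g = measure_pmf.expectation r (drift moves f)"
      if "set_pmf r \<subseteq> S" for r
      by (rule integral_cong_AE) (use that in \<open>auto simp: AE_measure_pmf_iff\<close>)
    have "\<bar>?g x\<bar> \<le> \<bar>2 * C * \<Lambda>\<bar>" for x
      using abs_drift_le[where f = f, OF _ f] by (force split: split_indicator)
    from conv[of ?g "\<bar>2 * C * \<Lambda>\<bar>", OF this] have "((\<lambda>i. measure_pmf.expectation (m i) (drift moves f))
        \<longlongrightarrow> measure_pmf.expectation q (drift moves f)) F'"
      by (simp add: on_S supp qS)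
    moreover have "((\<lambda>i. measure_pmf.expectation (m i) (drift moves f)) \<longlongrightarrow> 0) F'"
      by (rule tendsto_mono[OF \<open>F' \<le> F\<close> near]) (rule f)
    ultimately show ?thesis using F'(1) tendsto_unique by blast
  qed
  have "q = v"
  proof (rule balanced_unique[OF qS v(1)])
    show "measure_pmf.expectation q (drift moves f) = 0" if "\<And>x. \<bar>f x\<bar> \<le> C" for f C
      by (rule qz) (rule that)
    show "measure_pmf.expectation v (drift moves f) = 0" if "\<And>x. \<bar>f x\<bar> \<le> C" for f C
      by (rule v(2)) (rule that)
  qed (rule reach)
  with conv[of h B] h have "((\<lambda>i. measure_pmf.expectation (m i) h) \<longlongrightarrow> measure_pmf.expectation v h) F'"
    by blast
  then have "eventually ?near F'" using \<open>0 < e\<close> by (rule tendstoD)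
  moreover have "eventually (\<lambda>i. \<not> ?near i) F'"
    using F'(2) by (rule filter_leD) (simp add: F1_def eventually_inf_principal)
  ultimately have "eventually (\<lambda>_. False) F'" by eventually_elim simp
  with F'(1) show False by (simp add: eventually_False)
qed

end

section \<open>The two chains\<close>

lemma polling_chain:
  assumes "0 < lam1" "0 \<le> lam2" "0 < mu1" "0 < mu2" "0 < k1" "0 < k2"
  shows "bounded_rate_chain (polling_states k1 k2) (polling_moves lam1 lam2 mu1 mu2 k1 k2)
           (lam1 + lam2 + mu1 + mu2)"
proof -
  have in1: "after_service1 k1 n1 n2 j \<in> polling_states k1 k2"
    and in2: "after_service2 k2 n1 n2 j \<in> polling_states k1 k2" for n1 n2 j
    using assms by (simp_all add: polling_states_def after_service1_def after_service2_def)
  have "z \<in> polling_states k1 k2"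
    if "x \<in> polling_states k1 k2" "(r, z) \<in> set (polling_moves lam1 lam2 mu1 mu2 k1 k2 x)" for x r z
  proof -
    obtain n1 n2 s where x: "x = (n1, n2, s)" by (cases x)
    show ?thesis
    proof (cases s)
      case Idle
      then show ?thesis using that assms by (auto simp: x polling_states_def)
    next
      case (At1 j)
      then show ?thesis using that in1[of "n1 - 1" n2 "j + 1"] by (auto simp: x polling_states_def)
    next
      case (At2 j)
      then show ?thesis using that in2[of n1 "n2 - 1" "j + 1"] by (auto simp: x polling_states_def)
    qed
  qed
  then show ?thesis
    by unfold_locales (use assms in \<open>auto simp: polling_states_def\<close>)
qed

lemma vacation_chain:
  assumes "0 < lam1" "0 < mu1" "0 < mu2" "0 < k1" "0 < k2"
  shows "bounded_rate_chain (vacation_states k1 k2) (vacation_moves lam1 mu1 mu2 k1 k2)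
           (lam1 + mu1 + mu2)"
  by unfold_locales
     (use assms in \<open>auto simp: vacation_states_def split: if_splits\<close>)

text \<open>
  A path without arrivals: every visit serves at least one customer, and the vacations in between
  leave the queue unchanged.
\<close>
lemma vacation_reaches_empty:
  assumes "0 < lam1" "0 < mu1" "0 < mu2" "0 < k1" "0 < k2"
    and "x \<in> vacation_states k1 k2"
  shows "(x, (0, Vacation 0)) \<in> (step_rel (vacation_moves lam1 mu1 mu2 k1 k2))\<^sup>*"
proof -
  let ?step = "step_rel (vacation_moves lam1 mu1 mu2 k1 k2)"
  let ?R = "?step\<^sup>*"
  have stages: "((n, Vacation (k2 - Suc d)), (n, Vacation (k2 - 1))) \<in> ?R" if "d < k2" for n d
    using that
  proof (induction d)
    case (Suc d)
    then have "((n, Vacation (k2 - Suc (Suc d))), (n, Vacation (k2 - Suc d))) \<in> ?step"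
      using assms by (auto simp: step_rel_def Suc_diff_Suc)
    moreover have "((n, Vacation (k2 - Suc d)), (n, Vacation (k2 - 1))) \<in> ?R"
      using Suc by simp
    ultimately show ?case by (rule converse_rtrancl_into_rtrancl)
  qed simp
  have finish: "((n, Vacation m), (n, Vacation (k2 - 1))) \<in> ?R" if "m < k2" for n m
    using stages[of "k2 - Suc m" n] that by simp
  have last: "((n, Vacation (k2 - 1)), (if 0 < n then (n, Serving 0) else (n, Vacation 0))) \<in> ?step"
    for n
    using assms by (auto simp: step_rel_def)
  have serve: "\<exists>n'<n. ((n, Serving j), (n', Vacation 0)) \<in> ?R" if "j < k1" "0 < n" for n j
    using that
  proof (induction n arbitrary: j)
    case (Suc n)
    show ?case
    proof (cases "0 < n \<and> j + 1 < k1")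
      case True
      then have step: "((Suc n, Serving j), (n, Serving (Suc j))) \<in> ?step"
        using assms by (auto simp: step_rel_def)
      from True have "\<exists>n'<n. ((n, Serving (Suc j)), (n', Vacation 0)) \<in> ?R"
        by (intro Suc.IH) auto
      then obtain n' where n': "n' < n" "((n, Serving (Suc j)), (n', Vacation 0)) \<in> ?R"
        by blast
      have "((Suc n, Serving j), (n', Vacation 0)) \<in> ?R"
        using step n'(2) by (rule converse_rtrancl_into_rtrancl)
      then show ?thesis using n'(1) less_SucI by blast
    next
      case False
      then have "((Suc n, Serving j), (n, Vacation 0)) \<in> ?step"
        using assms by (auto simp: step_rel_def)
      then show ?thesis using lessI by blast
    qed
  qed simp
  have vac: "((n, Vacation m), (0, Vacation 0)) \<in> ?R" if "m < k2" for n m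
    using that
  proof (induction n arbitrary: m rule: less_induct)
    case (less n)
    have start: "((n, Vacation m), (if 0 < n then (n, Serving 0) else (n, Vacation 0))) \<in> ?R"
      using finish[OF less.prems] last[of n] by (rule rtrancl_into_rtrancl)
    show ?case
    proof (cases "0 < n")
      case True
      with serve[of 0 n] assms(4) obtain n' where "n' < n" "((n, Serving 0), (n', Vacation 0)) \<in> ?R"
        by blast
      moreover have "((n', Vacation 0), (0, Vacation 0)) \<in> ?R"
        using less.IH[OF \<open>n' < n\<close>] assms(5) by blast
      moreover have "((n, Vacation m), (n, Serving 0)) \<in> ?R" using start True by simp
      ultimately show ?thesis by (blast intro: rtrancl_trans)
    next
      case False
      then show ?thesis using start by simp
    qed
  qed
  from assms(6) show ?thesis
    unfolding vacation_states_def
  proof (elim UnE CollectE exE conjE)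
    fix n j assume x: "x = (n, Serving j)" "0 < n" "j < k1"
    with serve[of j n] obtain n' where "((n, Serving j), (n', Vacation 0)) \<in> ?R" by blast
    moreover have "((n', Vacation 0), (0, Vacation 0)) \<in> ?R" using assms(5) by (rule vac)
    ultimately show ?thesis unfolding x(1) by (rule rtrancl_trans)
  next
    fix n m assume x: "x = (n, Vacation m)" "m < k2"
    then show ?thesis using vac[of m n] by (simp only:)
  qed
qed

text \<open>
  How the polling system looks to an observer of the first queue: serving the second queue is a
  vacation, and \<open>j\<close> completed services there are \<open>j\<close> completed stages. The value at \<open>Idle\<close> is an
  arbitrary legal state, idleness having vanishing probability in the limit.
\<close>
fun vacation_view :: "polling_state \<Rightarrow> vacation_state" where
  "vacation_view (n1, n2, Idle) = (n1, Vacation 0)"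
| "vacation_view (n1, n2, At1 j) = (n1, Serving j)"
| "vacation_view (n1, n2, At2 j) = (n1, Vacation j)"

section \<open>The transform of the polling queue lengths\<close>

locale polling_system =
  fixes lam1 lam2 mu1 mu2 :: real and k1 k2 :: nat and p :: "polling_state pmf"
  assumes lam1: "0 < lam1" and lam2: "0 \<le> lam2" and mu1: "0 < mu1" and mu2: "0 < mu2"
    and k1: "0 < k1" and k2: "0 < k2"
    and stationary: "polling_stationary lam1 lam2 mu1 mu2 k1 k2 p"
begin

abbreviation "moves \<equiv> polling_moves lam1 lam2 mu1 mu2 k1 k2"
abbreviation "states \<equiv> polling_states k1 k2"
abbreviation "vmoves \<equiv> vacation_moves lam1 mu1 mu2 k1 k2"

sublocale bounded_rate_chain states moves "lam1 + lam2 + mu1 + mu2"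
  by (rule polling_chain[OF lam1 lam2 mu1 mu2 k1 k2])

lemma supp: "set_pmf p \<subseteq> states"
  using stationary by (simp add: polling_stationary_def stationary_distribution_def)

lemma drift_zero:
  "(\<And>x. \<bar>f x\<bar> \<le> B) \<Longrightarrow> measure_pmf.expectation p (drift moves f) = 0"
  by (rule stationary_drift_zero[where B = B]) (use stationary in \<open>auto simp: polling_stationary_def\<close>)

text \<open>
  The two bases satisfy \<open>\<mu>\<^sub>i (1 / r\<^sub>i - 1) = \<kappa>\<close>, so that a service in progress multiplies the
  function at relative rate \<open>\<kappa>\<close> at whichever queue it takes place. The value is the conditional
  Laplace transform at \<open>\<kappa>\<close> of the workload, given the queue lengths.
\<close>
definition queue_transform :: "real \<Rightarrow> polling_state \<Rightarrow> real" where
  "queue_transform \<kappa> = (\<lambda>(n1, n2, s). (mu1 / (mu1 + \<kappa>)) ^ n1 * (mu2 / (mu2 + \<kappa>)) ^ n2)"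

lemma queue_transform_bounds:
  assumes "0 \<le> \<kappa>"
  shows "0 \<le> queue_transform \<kappa> x" "queue_transform \<kappa> x \<le> 1"
  unfolding queue_transform_def using assms mu1 mu2
  by (auto simp: case_prod_unfold intro!: mult_le_one power_le_one)

lemma drift_queue_transform:
  assumes "0 < \<kappa>" "x \<in> states"
  shows "drift moves (queue_transform \<kappa>) x
    = \<kappa> * ((1 - lam1 / (mu1 + \<kappa>) - lam2 / (mu2 + \<kappa>)) * queue_transform \<kappa> x
           - indicator {(0, 0, Idle)} x)"
proof -
  define r1 where "r1 = mu1 / (mu1 + \<kappa>)"
  define r2 where "r2 = mu2 / (mu2 + \<kappa>)"
  have q: "queue_transform \<kappa> (n1, n2, s) = r1 ^ n1 * r2 ^ n2" for n1 n2 s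
    by (simp add: queue_transform_def r1_def r2_def)
  have a1: "queue_transform \<kappa> (after_service1 k1 n1 n2 j) = r1 ^ n1 * r2 ^ n2" for n1 n2 j
    by (simp add: after_service1_def q)
  have a2: "queue_transform \<kappa> (after_service2 k2 n1 n2 j) = r1 ^ n1 * r2 ^ n2" for n1 n2 j
    by (simp add: after_service2_def q)
  have lam: "lam1 * (r1 - 1) = - \<kappa> * (lam1 / (mu1 + \<kappa>))" "lam2 * (r2 - 1) = - \<kappa> * (lam2 / (mu2 + \<kappa>))"
    using mu1 mu2 assms(1) by (simp_all add: r1_def r2_def field_simps)
  have mu: "mu1 * (1 - r1) = \<kappa> * r1" "mu2 * (1 - r2) = \<kappa> * r2"
    using mu1 mu2 assms(1) by (simp_all add: r1_def r2_def field_simps)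
  obtain n1 n2 s where x: "x = (n1, n2, s)" by (cases x)
  have arrivals: "lam1 * (r1 ^ Suc n1 * r2 ^ n2 - r1 ^ n1 * r2 ^ n2)
      + lam2 * (r1 ^ n1 * r2 ^ Suc n2 - r1 ^ n1 * r2 ^ n2)
      = - \<kappa> * (lam1 / (mu1 + \<kappa>) + lam2 / (mu2 + \<kappa>)) * (r1 ^ n1 * r2 ^ n2)"
  proof -
    have "lam1 * (r1 ^ Suc n1 * r2 ^ n2 - r1 ^ n1 * r2 ^ n2)
      + lam2 * (r1 ^ n1 * r2 ^ Suc n2 - r1 ^ n1 * r2 ^ n2)
      = (lam1 * (r1 - 1) + lam2 * (r2 - 1)) * (r1 ^ n1 * r2 ^ n2)"
      by (simp add: algebra_simps)
    then show ?thesis unfolding lam by (simp add: algebra_simps)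
  qed
  show ?thesis
  proof (cases s)
    case Idle
    then have "n1 = 0" "n2 = 0" using assms(2) by (auto simp: x polling_states_def)
    then show ?thesis using arrivals by (simp add: x Idle drift_def q algebra_simps)
  next
    case (At1 j)
    then obtain m where m: "n1 = Suc m" using assms(2) by (cases n1) (auto simp: x polling_states_def)
    have "mu1 * (r1 ^ m * r2 ^ n2 - r1 ^ n1 * r2 ^ n2) = mu1 * (1 - r1) * (r1 ^ m * r2 ^ n2)"
      by (simp add: m algebra_simps)
    also have "\<dots> = \<kappa> * (r1 ^ n1 * r2 ^ n2)" unfolding mu by (simp add: m)
    finally show ?thesis using arrivals m by (simp add: x At1 drift_def q a1 algebra_simps)
  next
    case (At2 j)
    then obtain m where m: "n2 = Suc m" using assms(2) by (cases n2) (auto simp: x polling_states_def)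
    have "mu2 * (r1 ^ n1 * r2 ^ m - r1 ^ n1 * r2 ^ n2) = mu2 * (1 - r2) * (r1 ^ n1 * r2 ^ m)"
      by (simp add: m algebra_simps)
    also have "\<dots> = \<kappa> * (r1 ^ n1 * r2 ^ n2)" unfolding mu by (simp add: m)
    finally show ?thesis using arrivals m by (simp add: x At2 drift_def q a2 algebra_simps)
  qed
qed

lemma integrable_queue_transform:
  "0 \<le> \<kappa> \<Longrightarrow> integrable (measure_pmf p) (queue_transform \<kappa>)"
  by (rule integrable_pmf_bounded[where B = 1]) (simp add: queue_transform_bounds abs_of_nonneg)

text \<open>
  The Pollaczek-Khinchine formula for the workload, with the idle probability still unknown.
\<close>
lemma transform_idle:
  assumes "0 < \<kappa>"
  shows "(1 - lam1 / (mu1 + \<kappa>) - lam2 / (mu2 + \<kappa>)) * measure_pmf.expectation p (queue_transform \<kappa>)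
       = measure_pmf.prob p {(0, 0, Idle)}"
proof -
  let ?D = "1 - lam1 / (mu1 + \<kappa>) - lam2 / (mu2 + \<kappa>)"
  have int: "integrable (measure_pmf p) (queue_transform \<kappa>)"
    using assms by (intro integrable_queue_transform) simp
  have "measure_pmf.expectation p (drift moves (queue_transform \<kappa>)) = 0"
    by (rule drift_zero[where B = 1]) (use assms queue_transform_bounds[of \<kappa>] in \<open>simp add: abs_of_nonneg\<close>)
  also have "measure_pmf.expectation p (drift moves (queue_transform \<kappa>))
      = measure_pmf.expectation p (\<lambda>x. \<kappa> * (?D * queue_transform \<kappa> x - indicator {(0, 0, Idle)} x))"
    by (rule integral_cong_AE)
       (use supp drift_queue_transform[OF assms] in \<open>auto simp: AE_measure_pmf_iff\<close>)
  also have "\<dots> = \<kappa> * (?D * measure_pmf.expectation p (queue_transform \<kappa>)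
                     - measure_pmf.prob p {(0, 0, Idle)})"
    using int by simp
  finally show ?thesis using assms by simp
qed

lemma prob_idle: "measure_pmf.prob p {(0, 0, Idle)} = 1 - lam1 / mu1 - lam2 / mu2"
proof -
  define h where "h n = inverse (real (Suc n))" for n
  have h: "0 < h n" for n by (simp add: h_def)
  have lim_h: "h \<longlonglongrightarrow> 0" unfolding h_def by (rule LIMSEQ_inverse_real_of_nat)
  have "(\<lambda>n. measure_pmf.expectation p (queue_transform (h n))) \<longlonglongrightarrow> measure_pmf.expectation p (\<lambda>_. 1)"
  proof (rule integral_dominated_convergence[where w = "\<lambda>_. 1"])
    have "(\<lambda>n. (mu1 / (mu1 + h n)) ^ n1 * (mu2 / (mu2 + h n)) ^ n2)
        \<longlonglongrightarrow> (mu1 / (mu1 + 0)) ^ n1 * (mu2 / (mu2 + 0)) ^ n2" for n1 n2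
      using mu1 mu2 by (intro tendsto_intros lim_h) auto
    then have "(\<lambda>n. queue_transform (h n) x) \<longlonglongrightarrow> 1" for x
      using mu1 mu2 by (cases x) (auto simp: queue_transform_def)
    then show "AE x in measure_pmf p. (\<lambda>n. queue_transform (h n) x) \<longlonglongrightarrow> 1" by simp
    show "AE x in measure_pmf p. norm (queue_transform (h n) x) \<le> 1" for n
      using queue_transform_bounds[of "h n"] h[of n] by (simp add: abs_of_nonneg)
  qed auto
  then have "(\<lambda>n. (1 - lam1 / (mu1 + h n) - lam2 / (mu2 + h n))
      * measure_pmf.expectation p (queue_transform (h n)))
      \<longlonglongrightarrow> (1 - lam1 / (mu1 + 0) - lam2 / (mu2 + 0)) * 1"
    using mu1 mu2 by (intro tendsto_intros lim_h) auto
  then show ?thesis using transform_idle[OF h] by (simp add: LIMSEQ_const_iff)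
qed

section \<open>Comparison with the vacation queue\<close>

lemma vacation_view_in: "x \<in> states \<Longrightarrow> vacation_view x \<in> vacation_states k1 k2"
  using k2 by (auto simp: polling_states_def vacation_states_def)

text \<open>
  With at least two customers in the second queue, at least one is left after a departure there,
  and the server takes the same decisions as in the vacation queue. The two drifts then differ
  only through the change of the factor \<open>u ^ N2\<close> at an arrival to or a departure from the second
  queue.
\<close>
lemma drift_vacation_view_many:
  assumes x: "x \<in> states" and many: "1 < fst (snd x)"
    and u: "0 \<le> u" "u \<le> 1" and g: "\<And>y. \<bar>g y\<bar> \<le> B"
  shows "\<bar>drift moves (\<lambda>x. g (vacation_view x) * u ^ fst (snd x)) x
          - drift vmoves g (vacation_view x) * u ^ fst (snd x)\<bar> \<le> B * (lam2 + mu2) * (1 - u)"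
proof -
  obtain n1 n2 s where [simp]: "x = (n1, n2, s)" by (cases x)
  have n2: "1 < n2" using many by simp
  have B: "0 \<le> B" using g[of undefined] abs_ge_zero order_trans by blast
  have small: "\<bar>g y * (u ^ n * (1 - u))\<bar> \<le> B * (1 - u)" for y n
  proof -
    have "\<bar>g y\<bar> * (u ^ n * (1 - u)) \<le> B * (1 * (1 - u))"
      using u B g by (intro mult_mono power_le_one mult_right_mono) auto
    then show ?thesis using u by (simp add: abs_mult)
  qed
  have arr: "\<bar>lam2 * (g y * u ^ Suc n - g y * u ^ n)\<bar> \<le> B * lam2 * (1 - u)" for y n
  proof -
    have "lam2 * \<bar>g y * (u ^ n * (1 - u))\<bar> \<le> lam2 * (B * (1 - u))"
      using small lam2 by (rule mult_left_mono)
    moreover have "lam2 * (g y * u ^ Suc n - g y * u ^ n) = - (lam2 * (g y * (u ^ n * (1 - u))))"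
      by (simp add: algebra_simps)
    ultimately show ?thesis using lam2 by (simp add: abs_mult mult_ac)
  qed
  have dep: "\<bar>mu2 * (g y * u ^ n - g y * u ^ Suc n)\<bar> \<le> B * mu2 * (1 - u)" for y n
  proof -
    have "mu2 * \<bar>g y * (u ^ n * (1 - u))\<bar> \<le> mu2 * (B * (1 - u))"
      using small mu2 by (intro mult_left_mono) auto
    moreover have "mu2 * (g y * u ^ n - g y * u ^ Suc n) = mu2 * (g y * (u ^ n * (1 - u)))"
      by (simp add: algebra_simps)
    ultimately show ?thesis using mu2 by (simp add: abs_mult mult_ac)
  qed
  have "0 \<le> B * mu2 * (1 - u)" using B mu2 u by simp
  show ?thesis
  proof (cases s)
    case Idle
    then show ?thesis using x n2 by (auto simp: polling_states_def)
  next
    case (At1 j)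
    have view: "vacation_view (after_service1 k1 (n1 - 1) n2 (j + 1))
        = (if 0 < n1 - 1 \<and> j + 1 < k1 then (n1 - 1, Serving (j + 1)) else (n1 - 1, Vacation 0))"
      "fst (snd (after_service1 k1 (n1 - 1) n2 (j + 1))) = n2"
      using n2 by (auto simp: after_service1_def)
    have "drift moves (\<lambda>x. g (vacation_view x) * u ^ fst (snd x)) x
          - drift vmoves g (vacation_view x) * u ^ fst (snd x)
        = lam2 * (g (n1, Serving j) * u ^ Suc n2 - g (n1, Serving j) * u ^ n2)"
      using view by (simp add: At1 drift_def algebra_simps)
    then show ?thesis
      using arr[of "(n1, Serving j)" n2] \<open>0 \<le> B * mu2 * (1 - u)\<close>
      by (simp add: distrib_left distrib_right)
  next
    case (At2 j)
    obtain m where m: "n2 = Suc m" "0 < m" using n2 by (cases n2) auto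
    let ?y = "if j + 1 < k2 then (n1, Vacation (j + 1))
              else if 0 < n1 then (n1, Serving 0) else (n1, Vacation 0)"
    have view: "vacation_view (after_service2 k2 n1 (n2 - 1) (j + 1)) = ?y"
      "fst (snd (after_service2 k2 n1 (n2 - 1) (j + 1))) = m"
      using m by (auto simp: after_service2_def)
    have "drift moves (\<lambda>x. g (vacation_view x) * u ^ fst (snd x)) x
          - drift vmoves g (vacation_view x) * u ^ fst (snd x)
        = lam2 * (g (n1, Vacation j) * u ^ Suc n2 - g (n1, Vacation j) * u ^ n2)
          + mu2 * (g ?y * u ^ m - g ?y * u ^ Suc m)"
      using view m(1) by (simp add: At2 drift_def algebra_simps)
    then show ?thesis
      using arr[of "(n1, Vacation j)" n2] dep[of ?y m] by (simp add: distrib_left distrib_right)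
  qed
qed

lemma drift_vacation_view:
  assumes x: "x \<in> states" and u: "0 \<le> u" "u \<le> 1" and g: "\<And>y. \<bar>g y\<bar> \<le> B"
  shows "\<bar>drift moves (\<lambda>x. g (vacation_view x) * u ^ fst (snd x)) x
          - drift vmoves g (vacation_view x) * u ^ fst (snd x)\<bar>
       \<le> B * (lam2 + mu2) * (1 - u)
         + 4 * B * (lam1 + lam2 + mu1 + mu2) * indicator {x. fst (snd x) \<le> 1} x"
proof (cases "1 < fst (snd x)")
  case True
  then show ?thesis using drift_vacation_view_many[OF x _ u g] by simp
next
  case False
  have B: "0 \<le> B" using g[of undefined] abs_ge_zero order_trans by blast
  interpret V: bounded_rate_chain "vacation_states k1 k2" vmoves "lam1 + mu1 + mu2"
    by (rule vacation_chain[OF lam1 mu1 mu2 k1 k2])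
  have "\<bar>g (vacation_view y) * u ^ fst (snd y)\<bar> \<le> B" for y
    using mult_mono[OF g[of "vacation_view y"] power_le_one[OF u] B] u by (simp add: abs_mult)
  then have 1: "\<bar>drift moves (\<lambda>x. g (vacation_view x) * u ^ fst (snd x)) x\<bar>
      \<le> 2 * B * (lam1 + lam2 + mu1 + mu2)"
    by (rule abs_drift_le[OF x])
  have "\<bar>drift vmoves g (vacation_view x)\<bar> * u ^ fst (snd x) \<le> (2 * B * (lam1 + mu1 + mu2)) * 1"
    using V.abs_drift_le[where f = g, OF vacation_view_in[OF x] g] u B lam1 mu1 mu2
    by (intro mult_mono power_le_one) auto
  also have "\<dots> \<le> 2 * B * (lam1 + lam2 + mu1 + mu2)"
    using B lam2 by (simp add: mult_left_mono)
  finally have 2: "\<bar>drift vmoves g (vacation_view x) * u ^ fst (snd x)\<bar> \<le> 2 * B * (lam1 + lam2 + mu1 + mu2)"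
    using u by (simp add: abs_mult)
  have "0 \<le> B * (lam2 + mu2) * (1 - u)" using B lam2 mu2 u by simp
  with 1 2 False show ?thesis by simp
qed

text \<open>
  Balance for the polling system becomes approximate balance for the vacation queue under the
  weight \<open>u ^ N2\<close>. The error vanishes when \<open>u\<close> tends to 1 and the second queue is rarely short.
\<close>
lemma vacation_drift_small:
  assumes u: "0 \<le> u" "u \<le> 1" and g: "\<And>y. \<bar>g y\<bar> \<le> B"
  shows "\<bar>measure_pmf.expectation p (\<lambda>x. drift vmoves g (vacation_view x) * u ^ fst (snd x))\<bar>
       \<le> B * (lam2 + mu2) * (1 - u)
         + 4 * B * (lam1 + lam2 + mu1 + mu2) * measure_pmf.prob p {x. fst (snd x) \<le> 1}"
proof -
  let ?f = "\<lambda>x. g (vacation_view x) * u ^ fst (snd x)"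
  let ?G = "\<lambda>x. drift vmoves g (vacation_view x) * u ^ fst (snd x)"
  let ?C = "4 * B * (lam1 + lam2 + mu1 + mu2)"
  have B: "0 \<le> B" using g[of undefined] abs_ge_zero order_trans by blast
  interpret V: bounded_rate_chain "vacation_states k1 k2" vmoves "lam1 + mu1 + mu2"
    by (rule vacation_chain[OF lam1 mu1 mu2 k1 k2])
  have f: "\<bar>?f y\<bar> \<le> B" for y
    using mult_mono[OF g[of "vacation_view y"] power_le_one[OF u] B] u by (simp add: abs_mult)
  have intf: "integrable (measure_pmf p) (drift moves ?f)"
    by (rule integrable_pmf_bounded, rule abs_drift_le) (use f supp in auto)
  have "\<bar>?G x\<bar> \<le> (2 * B * (lam1 + mu1 + mu2)) * 1" if "x \<in> set_pmf p" for x
    using V.abs_drift_le[where f = g, OF vacation_view_in g, of x] that supp u B lam1 mu1 mu2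
    unfolding abs_mult by (intro mult_mono) (auto intro: power_le_one)
  then have intG: "integrable (measure_pmf p) ?G" by (rule integrable_pmf_bounded)
  have "measure_pmf.expectation p (drift moves ?f) = 0" by (rule drift_zero) (rule f)
  then have "\<bar>measure_pmf.expectation p ?G\<bar>
      = \<bar>measure_pmf.expectation p (\<lambda>x. drift moves ?f x - ?G x)\<bar>"
    using intf intG by simp
  also have "\<dots> \<le> measure_pmf.expectation p
      (\<lambda>x. B * (lam2 + mu2) * (1 - u) + ?C * indicator {x. fst (snd x) \<le> 1} x)"
    by (rule abs_expectation_le, rule drift_vacation_view) (use u g supp in auto)
  also have "\<dots> = B * (lam2 + mu2) * (1 - u) + ?C * measure_pmf.prob p {x. fst (snd x) \<le> 1}"
    by simp
  finally show ?thesis .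
qed

end

section \<open>Tightness of the first queue\<close>

text \<open>
  The next two bounds are for one arrival at rate \<open>\<nu>\<close> and one service event of rate \<open>\<mu>\<close> and
  jump \<open>\<Delta>\<close>: squaring a function of negative drift gives a drift proportional to minus the function,
  up to a constant.
\<close>
lemma square_step_inward:
  fixes l :: real
  assumes "0 \<le> l" "0 \<le> \<mu>" "\<bar>\<Delta>\<bar> \<le> D" "\<nu> + \<mu> * \<Delta> \<le> - \<epsilon>"
  shows "\<nu> * ((l + 1)\<^sup>2 - l\<^sup>2) + \<mu> * ((l + \<Delta>)\<^sup>2 - l\<^sup>2) \<le> \<nu> + \<mu> * D\<^sup>2 - 2 * \<epsilon> * l"
proof -
  have "\<Delta>\<^sup>2 \<le> D\<^sup>2" using assms(3) by (simp add: abs_le_square_iff[symmetric])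
  then have "\<mu> * \<Delta>\<^sup>2 \<le> \<mu> * D\<^sup>2" using assms(2) by (rule mult_left_mono)
  moreover have "2 * l * (\<nu> + \<mu> * \<Delta>) \<le> 2 * l * (- \<epsilon>)"
    using assms by (intro mult_left_mono) auto
  ultimately show ?thesis by (simp add: power2_eq_square algebra_simps)
qed

lemma square_step_bounded:
  fixes l :: real
  assumes "0 \<le> l" "l \<le> D" "0 \<le> \<mu>" "\<bar>\<Delta>\<bar> \<le> D"
  shows "\<mu> * ((l + \<Delta>)\<^sup>2 - l\<^sup>2) \<le> 3 * \<mu> * D\<^sup>2"
proof -
  have "\<Delta>\<^sup>2 \<le> D\<^sup>2" using assms(4) by (simp add: abs_le_square_iff[symmetric])
  moreover have "l * \<Delta> \<le> D * D"
  proof -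
    have "l * \<Delta> \<le> l * D" using assms by (intro mult_left_mono) auto
    also have "\<dots> \<le> D * D" using assms by (intro mult_right_mono) auto
    finally show ?thesis .
  qed
  ultimately have "(l + \<Delta>)\<^sup>2 - l\<^sup>2 \<le> 3 * D\<^sup>2"
    by (simp add: power2_eq_square algebra_simps)
  from mult_left_mono[OF this assms(3)] show ?thesis by (simp add: mult_ac)
qed

locale subcritical_polling = polling_system +
  assumes queue1_stable: "lam1 / real k1 < mu2 * (1 - lam1 / mu1) / real k2"
begin

text \<open>
  The maximal throughput of the first queue when both queues are saturated: \<open>k1\<close> services per
  cycle of mean length \<open>k1 / mu1 + k2 / mu2\<close>.
\<close>
definition capacity :: real where
  "capacity = real k1 / (real k1 / mu1 + real k2 / mu2)"

text \<open>
  Potential of a position in the cycle. A service in an unbroken cycle moves \<open>N1\<close> plus the potential by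
  \<open>- capacity / \<mu>\<close>, where \<open>\<mu>\<close> is the service rate, so that the departures act as a steady outflow of
  rate \<open>capacity\<close> throughout the cycle; cutting a visit to the second queue short
  only lowers the potential further, and a visit to the first queue is cut short only by its becoming
  empty, where a bounded drift suffices. At \<open>Idle\<close> the potential is that of \<open>At2 0\<close>, which makes the
  arrivals to the second queue invisible.
\<close>
definition cycle_phase :: "server \<Rightarrow> real" where
  "cycle_phase s = (case s of
      At1 j \<Rightarrow> real j * (1 - capacity / mu1)
    | At2 j \<Rightarrow> (real k2 - real j) * (capacity / mu2)
    | Idle \<Rightarrow> real k2 * (capacity / mu2))"

definition level :: "polling_state \<Rightarrow> real" where
  "level = (\<lambda>(n1, n2, s). real n1 + cycle_phase s)"

lemma capacity_pos: "0 < capacity"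
  using k1 k2 mu1 mu2 by (simp add: capacity_def add_pos_pos)

lemma lam1_less_capacity: "lam1 < capacity"
proof -
  have "lam1 * real k2 < mu2 * (1 - lam1 / mu1) * real k1"
    using queue1_stable k1 k2 by (simp add: field_simps)
  then have "lam1 * real k2 / mu2 < (1 - lam1 / mu1) * real k1"
    using mu2 by (simp add: pos_divide_less_eq mult_ac)
  then have "lam1 * (real k1 / mu1 + real k2 / mu2) < real k1"
    by (simp add: algebra_simps)
  then show ?thesis
    unfolding capacity_def using k1 k2 mu1 mu2 by (subst pos_less_divide_eq) (auto intro: add_pos_pos)
qed

lemma capacity_balance: "real k1 * (1 - capacity / mu1) = real k2 * (capacity / mu2)"
proof -
  have "0 < real k1 / mu1 + real k2 / mu2" using k1 k2 mu1 mu2 by (simp add: add_pos_pos)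
  then have "capacity * (real k1 / mu1 + real k2 / mu2) = real k1"
    by (simp add: capacity_def)
  then show ?thesis by (simp add: algebra_simps)
qed

lemma capacity_le_mu1: "0 < 1 - capacity / mu1"
proof -
  have "0 < real k2 * (capacity / mu2)" using k2 mu2 capacity_pos by simp
  then have "0 < real k1 * (1 - capacity / mu1)" by (simp only: capacity_balance)
  then show ?thesis using k1 by (simp add: zero_less_mult_iff)
qed

definition max_phase :: real where "max_phase = real k2 * (capacity / mu2)"

lemma max_phase_nonneg: "0 \<le> max_phase"
  using mu2 capacity_pos by (simp add: max_phase_def)

lemma cycle_phase_bounds:
  assumes "(n1, n2, s) \<in> states"
  shows "0 \<le> cycle_phase s" "cycle_phase s \<le> max_phase"
proof -
  have "0 \<le> cycle_phase s \<and> cycle_phase s \<le> max_phase"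
  proof (cases s)
    case (At1 j)
    then have "real j \<le> real k1" using assms by (auto simp: polling_states_def)
    then have "real j * (1 - capacity / mu1) \<le> real k1 * (1 - capacity / mu1)"
      using capacity_le_mu1 by (intro mult_right_mono) auto
    then show ?thesis
      using capacity_le_mu1 At1 by (simp add: cycle_phase_def max_phase_def capacity_balance)
  next
    case (At2 j)
    then have "real j \<le> real k2" using assms by (auto simp: polling_states_def)
    then have "0 \<le> (real k2 - real j) * (capacity / mu2)"
      "(real k2 - real j) * (capacity / mu2) \<le> real k2 * (capacity / mu2)"
      using capacity_pos mu2 mult_right_mono[of "real k2 - real j" "real k2" "capacity / mu2"]
      by (auto intro!: mult_nonneg_nonneg)
    then show ?thesis using At2 by (simp add: cycle_phase_def max_phase_def)
  next
    case Idle
    then show ?thesis using max_phase_nonneg by (simp add: cycle_phase_def max_phase_def)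
  qed
  then show "0 \<le> cycle_phase s" "cycle_phase s \<le> max_phase" by auto
qed

text \<open>
  The spare capacity of the first queue, and a bound for the drift of the squared level. Neither
  depends on \<open>lam2\<close>, and this makes the tightness below uniform in heavy traffic.
\<close>
definition gap :: real where "gap = capacity - lam1"

definition drift_const :: real where
  "drift_const = 3 * (lam1 + mu1 + mu2) * (1 + max_phase)\<^sup>2 + 2 * gap * (1 + max_phase)"

lemma gap_pos: "0 < gap" using lam1_less_capacity by (simp add: gap_def)

lemma level_step1:
  assumes "(Suc m, n2, At1 j) \<in> states"
  defines "\<Delta> \<equiv> level (after_service1 k1 m n2 (Suc j)) - level (Suc m, n2, At1 j)"
  shows "\<bar>\<Delta>\<bar> \<le> 1 + max_phase" "0 < m \<Longrightarrow> \<Delta> \<le> - (capacity / mu1)"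
proof -
  let ?b = "1 - capacity / mu1"
  let ?y = "after_service1 k1 m n2 (Suc j)"
  have j: "j < k1" using assms(1) by (auto simp: polling_states_def)
  have y: "?y \<in> states" using k1 k2 by (simp add: after_service1_def polling_states_def)
  have "fst ?y = m \<and> fst (snd ?y) = n2" by (simp add: after_service1_def)
  then obtain s where s: "?y = (m, n2, s)" by (cases ?y) auto
  have \<Delta>: "\<Delta> = cycle_phase s - cycle_phase (At1 j) - 1"
    by (simp add: \<Delta>_def s level_def)
  show "\<bar>\<Delta>\<bar> \<le> 1 + max_phase"
    using cycle_phase_bounds[OF assms(1)] cycle_phase_bounds[OF y[unfolded s]] unfolding \<Delta> by linarith
  assume "0 < m"
  have "cycle_phase s - cycle_phase (At1 j) \<le> ?b"
  proof (cases "Suc j < k1")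
    case True
    then have "s = At1 (Suc j)" using s \<open>0 < m\<close> by (simp add: after_service1_def)
    then show ?thesis by (simp add: cycle_phase_def algebra_simps add_divide_distrib)
  next
    case False
    then have k: "real k1 = real j + 1" using j by linarith
    have "cycle_phase s \<le> (real j + 1) * ?b"
      using cycle_phase_bounds(2)[OF y[unfolded s]]
      by (simp add: k[symmetric] capacity_balance max_phase_def)
    moreover have "cycle_phase (At1 j) = real j * ?b" by (simp add: cycle_phase_def)
    ultimately show ?thesis by (simp add: distrib_right)
  qed
  then show "\<Delta> \<le> - (capacity / mu1)" unfolding \<Delta> by simp
qed

lemma level_step2:
  assumes "(n1, Suc m, At2 j) \<in> states"
  defines "\<Delta> \<equiv> level (after_service2 k2 n1 m (Suc j)) - level (n1, Suc m, At2 j)"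
  shows "\<bar>\<Delta>\<bar> \<le> 1 + max_phase" "0 < n1 \<Longrightarrow> \<Delta> \<le> - (capacity / mu2)"
proof -
  let ?c = "capacity / mu2"
  let ?y = "after_service2 k2 n1 m (Suc j)"
  have j: "j < k2" using assms(1) by (auto simp: polling_states_def)
  have y: "?y \<in> states" using k1 k2 by (simp add: after_service2_def polling_states_def)
  have "fst ?y = n1 \<and> fst (snd ?y) = m" by (simp add: after_service2_def)
  then obtain s where s: "?y = (n1, m, s)" by (cases ?y) auto
  have \<Delta>: "\<Delta> = cycle_phase s - cycle_phase (At2 j)"
    by (simp add: \<Delta>_def s level_def)
  show "\<bar>\<Delta>\<bar> \<le> 1 + max_phase"
    using cycle_phase_bounds[OF assms(1)] cycle_phase_bounds[OF y[unfolded s]] unfolding \<Delta> by linarith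
  assume "0 < n1"
  show "\<Delta> \<le> - ?c"
  proof (cases "0 < m \<and> Suc j < k2")
    case True
    then have "s = At2 (Suc j)" using s by (simp add: after_service2_def)
    then show ?thesis unfolding \<Delta> by (simp add: cycle_phase_def algebra_simps add_divide_distrib diff_divide_distrib)
  next
    case False
    then have "s = At1 0" using s \<open>0 < n1\<close> by (auto simp: after_service2_def split: if_splits)
    moreover have "1 * ?c \<le> (real k2 - real j) * ?c"
      using j capacity_pos mu2 by (intro mult_right_mono) auto
    ultimately show ?thesis unfolding \<Delta> by (simp add: cycle_phase_def)
  qed
qed

lemma level_ge: "x \<in> states \<Longrightarrow> real (fst x) \<le> level x"
  and level_le: "x \<in> states \<Longrightarrow> level x \<le> real (fst x) + max_phase"
  using cycle_phase_bounds by (cases x; force simp: level_def)+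

lemma drift_const_inward:
  assumes "\<mu> \<in> {mu1, mu2}"
  shows "lam1 + \<mu> * (1 + max_phase)\<^sup>2 \<le> drift_const"
proof -
  have D: "1 \<le> (1 + max_phase)\<^sup>2" using max_phase_nonneg by (simp add: one_le_power)
  have "lam1 * 1 \<le> lam1 * (1 + max_phase)\<^sup>2" using D lam1 by (intro mult_left_mono) auto
  moreover have "0 \<le> mu1 * (1 + max_phase)\<^sup>2" "0 \<le> mu2 * (1 + max_phase)\<^sup>2"
    "0 \<le> lam1 * (1 + max_phase)\<^sup>2" "0 \<le> 2 * gap * (1 + max_phase)"
    using mu1 mu2 lam1 gap_pos max_phase_nonneg by auto
  ultimately show ?thesis using assms by (auto simp: drift_const_def algebra_simps)
qed

lemma drift_const_low:
  assumes "\<mu> \<in> {mu1, mu2}" "l \<le> 1 + max_phase"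
  shows "3 * lam1 * (1 + max_phase)\<^sup>2 + 3 * \<mu> * (1 + max_phase)\<^sup>2 \<le> drift_const - 2 * gap * l"
proof -
  have "gap * l \<le> gap * (1 + max_phase)" using assms(2) gap_pos by (intro mult_left_mono) auto
  moreover have "0 \<le> mu1 * (1 + max_phase)\<^sup>2" "0 \<le> mu2 * (1 + max_phase)\<^sup>2"
    using mu1 mu2 by auto
  ultimately show ?thesis using assms(1) by (auto simp: drift_const_def algebra_simps)
qed

lemma drift_level_square:
  assumes x: "x \<in> states"
  shows "drift moves (\<lambda>x. (level x)\<^sup>2) x \<le> drift_const - 2 * gap * level x"
proof -
  obtain n1 n2 s where xs: "x = (n1, n2, s)" by (cases x)
  let ?D = "1 + max_phase"
  let ?l = "level x"
  have l: "0 \<le> ?l" using level_ge[OF x] by simp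
  have D: "0 \<le> ?D" using max_phase_nonneg by simp
  have key: "lam1 * ((?l + 1)\<^sup>2 - ?l\<^sup>2) + \<mu> * ((?l + \<Delta>)\<^sup>2 - ?l\<^sup>2) \<le> drift_const - 2 * gap * ?l"
    if \<mu>: "\<mu> \<in> {mu1, mu2}" and \<Delta>: "\<bar>\<Delta>\<bar> \<le> ?D"
      and dir: "(\<Delta> \<le> - (capacity / \<mu>)) \<or> n1 \<le> 1" for \<mu> \<Delta>
  proof -
    have pos: "0 < \<mu>" using \<mu> mu1 mu2 by auto
    from dir show ?thesis
    proof
      assume "\<Delta> \<le> - (capacity / \<mu>)"
      then have "\<mu> * \<Delta> \<le> \<mu> * - (capacity / \<mu>)" using pos by (intro mult_left_mono) auto
      also have "\<mu> * - (capacity / \<mu>) = - capacity" using pos by simp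
      finally have "lam1 + \<mu> * \<Delta> \<le> - gap" by (simp add: gap_def)
      from square_step_inward[OF l _ \<Delta> this] drift_const_inward[OF \<mu>] pos show ?thesis by simp
    next
      assume "n1 \<le> 1"
      then have lD: "?l \<le> ?D" using level_le[OF x] by (simp add: xs)
      have "lam1 * ((?l + 1)\<^sup>2 - ?l\<^sup>2) \<le> 3 * lam1 * ?D\<^sup>2"
        by (rule square_step_bounded[OF l lD]) (use lam1 max_phase_nonneg in auto)
      moreover have "\<mu> * ((?l + \<Delta>)\<^sup>2 - ?l\<^sup>2) \<le> 3 * \<mu> * ?D\<^sup>2"
        by (rule square_step_bounded[OF l lD]) (use pos \<Delta> in auto)
      ultimately show ?thesis using drift_const_low[OF \<mu> lD] by simp
    qed
  qed
  show ?thesis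
  proof (cases s)
    case Idle
    then have n: "n1 = 0" "n2 = 0" using x by (auto simp: xs polling_states_def)
    have lm: "?l = max_phase" by (simp add: xs n Idle level_def cycle_phase_def max_phase_def)
    have "drift moves (\<lambda>x. (level x)\<^sup>2) x = lam1 * ((?l + (1 - max_phase))\<^sup>2 - ?l\<^sup>2)"
      by (simp add: lm) (simp add: xs n Idle drift_def level_def cycle_phase_def max_phase_def)
    also have "\<dots> \<le> 3 * lam1 * ?D\<^sup>2"
      by (rule square_step_bounded[OF l]) (use lam1 lm max_phase_nonneg in auto)
    also have "\<dots> \<le> drift_const - 2 * gap * ?l"
    proof -
      have "0 \<le> 3 * mu1 * ?D\<^sup>2" using mu1 by simp
      with drift_const_low[of mu1 ?l] lm show ?thesis by simp
    qed
    finally show ?thesis .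
  next
    case (At1 j)
    then obtain m where m: "n1 = Suc m" using x by (cases n1) (auto simp: xs polling_states_def)
    define \<Delta> where "\<Delta> = level (after_service1 k1 m n2 (Suc j)) - ?l"
    have "drift moves (\<lambda>x. (level x)\<^sup>2) x = lam1 * ((?l + 1)\<^sup>2 - ?l\<^sup>2) + mu1 * ((?l + \<Delta>)\<^sup>2 - ?l\<^sup>2)"
      unfolding \<Delta>_def by (simp add: xs m At1 drift_def level_def add_ac)
    moreover have "\<bar>\<Delta>\<bar> \<le> ?D" "0 < m \<Longrightarrow> \<Delta> \<le> - (capacity / mu1)"
      using level_step1[of m n2 j] x by (simp_all add: xs m At1 \<Delta>_def)
    ultimately show ?thesis using key[of mu1 \<Delta>] m by (cases "m = 0") auto
  next
    case (At2 j)
    then obtain m where m: "n2 = Suc m" using x by (cases n2) (auto simp: xs polling_states_def)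
    define \<Delta> where "\<Delta> = level (after_service2 k2 n1 m (Suc j)) - ?l"
    have "drift moves (\<lambda>x. (level x)\<^sup>2) x = lam1 * ((?l + 1)\<^sup>2 - ?l\<^sup>2) + mu2 * ((?l + \<Delta>)\<^sup>2 - ?l\<^sup>2)"
      unfolding \<Delta>_def by (simp add: xs m At2 drift_def level_def add_ac)
    moreover have "\<bar>\<Delta>\<bar> \<le> ?D" "0 < n1 \<Longrightarrow> \<Delta> \<le> - (capacity / mu2)"
      using level_step2[of n1 m j] x by (simp_all add: xs m At2 \<Delta>_def)
    ultimately show ?thesis using key[of mu2 \<Delta>] by (cases "n1 = 0") auto
  qed
qed

text \<open>
  Test with the squared level capped at \<open>R\<^sup>2\<close>, which is bounded: below the cap the capping only
  lowers the drift, and above it the drift is nonpositive.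
\<close>
lemma truncated_level_moment:
  assumes "0 \<le> R"
  shows "measure_pmf.expectation p (\<lambda>x. level x * indicator {x. level x < R} x) \<le> drift_const / (2 * gap)"
proof -
  define f where "f x = min ((level x)\<^sup>2) (R\<^sup>2)" for x
  let ?g = "\<lambda>x. level x * indicator {x. level x < R} x"
  have f: "\<bar>f x\<bar> \<le> R\<^sup>2" for x by (simp add: f_def)
  have pt: "drift moves f x \<le> drift_const - 2 * gap * ?g x" if x: "x \<in> states" for x
  proof (cases "level x < R")
    case True
    have "(level x)\<^sup>2 \<le> R\<^sup>2" using True level_ge[OF x] by (intro power_mono) auto
    then have "drift moves f x \<le> drift moves (\<lambda>x. (level x)\<^sup>2) x"
      unfolding drift_def
      by (intro sum_list_mono) (use rate_nonneg[OF x] in \<open>auto simp: f_def intro!: mult_left_mono\<close>)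
    with drift_level_square[OF x] True show ?thesis by simp
  next
    case False
    then have "R\<^sup>2 \<le> (level x)\<^sup>2" using assms by (intro power_mono) auto
    then have "drift moves f x \<le> 0"
      unfolding drift_def
      by (intro sum_list_nonpos) (use rate_nonneg[OF x] in \<open>auto simp: f_def intro!: mult_nonneg_nonpos\<close>)
    moreover have "0 \<le> drift_const"
      using gap_pos lam1 mu1 mu2 max_phase_nonneg by (simp add: drift_const_def)
    ultimately show ?thesis using False by simp
  qed
  have intf: "integrable (measure_pmf p) (drift moves f)"
    by (rule integrable_pmf_bounded, rule abs_drift_le) (use f supp in auto)
  have intg: "integrable (measure_pmf p) ?g"
    by (rule integrable_pmf_bounded[where B = R])
       (use supp level_ge assms in \<open>force split: split_indicator\<close>)
  have "0 = measure_pmf.expectation p (drift moves f)"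
    using drift_zero[where f = f, OF f] by simp
  also have "\<dots> \<le> measure_pmf.expectation p (\<lambda>x. drift_const - 2 * gap * ?g x)"
    by (rule integral_mono_AE) (use intf intg supp pt in \<open>auto simp: AE_measure_pmf_iff\<close>)
  also have "\<dots> = drift_const - 2 * gap * measure_pmf.expectation p ?g"
    using intg by simp
  finally show ?thesis using gap_pos by (simp add: pos_le_divide_eq mult_ac)
qed

lemma queue1_tail:
  assumes "0 < m"
  shows "measure_pmf.prob p {x. m \<le> fst x} \<le> drift_const / (2 * gap) / real m"
proof -
  let ?A = "{x :: polling_state. m \<le> fst x}"
  have "(\<lambda>n. measure_pmf.expectation p (\<lambda>x. indicator ?A x * indicator {x. level x < real n} x))
      \<longlonglongrightarrow> measure_pmf.expectation p (\<lambda>x. indicator ?A x :: real)"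
  proof (rule integral_dominated_convergence[where w = "\<lambda>_. 1"])
    show "AE x in measure_pmf p.
        (\<lambda>n. indicator ?A x * indicator {x. level x < real n} x) \<longlonglongrightarrow> (indicator ?A x :: real)"
    proof (rule AE_I2)
      fix x :: polling_state
      obtain N :: nat where "level x < real N" using reals_Archimedean2 by blast
      then have "\<forall>\<^sub>F n in sequentially.
          indicator ?A x * indicator {x. level x < real n} x = (indicator ?A x :: real)"
        by (intro eventually_sequentiallyI[of N]) auto
      then show "(\<lambda>n. indicator ?A x * indicator {x. level x < real n} x) \<longlonglongrightarrow> (indicator ?A x :: real)"
        by (rule tendsto_eventually)
    qed
  qed (auto split: split_indicator)
  moreover have "measure_pmf.expectation p (\<lambda>x. indicator ?A x * indicator {x. level x < real n} x)
      \<le> drift_const / (2 * gap) / real m" for n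
  proof -
    have "real m * measure_pmf.expectation p (\<lambda>x. indicator ?A x * indicator {x. level x < real n} x)
        = measure_pmf.expectation p (\<lambda>x. real m * (indicator ?A x * indicator {x. level x < real n} x))"
      by simp
    also have "\<dots> \<le> measure_pmf.expectation p (\<lambda>x. level x * indicator {x. level x < real n} x)"
    proof (rule integral_mono_AE)
      show "integrable (measure_pmf p) (\<lambda>x. level x * indicator {x. level x < real n} x)"
        by (rule integrable_pmf_bounded[where B = "real n"])
           (use supp level_ge in \<open>force split: split_indicator\<close>)
      show "integrable (measure_pmf p)
          (\<lambda>x. real m * (indicator ?A x * indicator {x. level x < real n} x))"
        by (rule integrable_pmf_bounded[where B = "real m"]) (auto split: split_indicator)
      show "AE x in measure_pmf p. real m * (indicator ?A x * indicator {x. level x < real n} x)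
          \<le> level x * indicator {x. level x < real n} x"
        unfolding AE_measure_pmf_iff
      proof
        fix x assume "x \<in> set_pmf p"
        then have "real (fst x) \<le> level x" by (intro level_ge subsetD[OF supp])
        then show "real m * (indicator ?A x * indicator {x. level x < real n} x)
            \<le> level x * indicator {x. level x < real n} x"
          by (auto split: split_indicator)
      qed
    qed
    also have "\<dots> \<le> drift_const / (2 * gap)" by (rule truncated_level_moment) simp
    finally show ?thesis using assms by (subst pos_le_divide_eq) (simp_all add: mult.commute)
  qed
  ultimately have "measure_pmf.expectation p (\<lambda>x. indicator ?A x) \<le> drift_const / (2 * gap) / real m"
    by (intro LIMSEQ_le_const2) auto
  then show ?thesis by simp
qed

end

section \<open>Recovering a tail probability from moments\<close>

text \<open>
  The method of moments on \<open>[0, 1]\<close> for the subprobabilities obtained by weighting with \<open>w\<close>: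
  polynomials are uniformly dense.
\<close>
lemma moments_imp_continuous_functional:
  fixes p :: "'i \<Rightarrow> 's pmf" and w :: "'s \<Rightarrow> real" and Y :: "'i \<Rightarrow> 's \<Rightarrow> real"
    and M :: "'m measure" and Z :: "'m \<Rightarrow> real" and \<phi> :: "real \<Rightarrow> real"
  assumes w: "\<And>x. 0 \<le> w x" "\<And>x. w x \<le> 1"
    and Y: "\<forall>\<^sub>F i in F. \<forall>x. Y i x \<in> {0..1}"
    and M: "prob_space M" "Z \<in> borel_measurable M" "AE x in M. Z x \<in> {0..1}"
    and L: "0 \<le> L" "L \<le> 1"
    and moments: "\<And>k. ((\<lambda>i. measure_pmf.expectation (p i) (\<lambda>x. w x * Y i x ^ k))
                     \<longlongrightarrow> L * (\<integral>x. Z x ^ k \<partial>M)) F"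
    and \<phi>: "continuous_on UNIV \<phi>"
  shows "((\<lambda>i. measure_pmf.expectation (p i) (\<lambda>x. w x * \<phi> (Y i x))) \<longlongrightarrow> L * (\<integral>x. \<phi> (Z x) \<partial>M)) F"
proof (rule tendstoI)
  fix e :: real assume "0 < e"
  interpret M: prob_space M by fact
  have "continuous_on {0..1} \<phi>" using \<phi> by (rule continuous_on_subset) simp
  then obtain g where g: "real_polynomial_function g" "\<And>y. y \<in> {0..1} \<Longrightarrow> \<bar>\<phi> y - g y\<bar> < e / 4"
    using Stone_Weierstrass_real_polynomial_function[of "{0..1}" \<phi> "e / 4"] \<open>0 < e\<close> by auto
  then obtain a n where a: "g = (\<lambda>y. \<Sum>k\<le>n. a k * y ^ k)"
    unfolding real_polynomial_function_iff_sum by auto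
  have "compact (\<phi> ` {0..1})"
    by (rule compact_continuous_image) (use \<open>continuous_on {0..1} \<phi>\<close> in auto)
  then have "bounded (\<phi> ` {0..1})" by (rule compact_imp_bounded)
  then obtain K where "\<forall>y\<in>{0..1}. \<bar>\<phi> y\<bar> \<le> K" by (auto simp: bounded_iff)
  then have K: "\<bar>\<phi> y\<bar> \<le> K" if "y \<in> {0..1}" for y using that by blast
  have pow: "\<bar>y ^ k\<bar> \<le> 1" if "y \<in> {0..1}" for y :: real and k
    using that by (simp add: power_le_one power_abs)
  have int\<phi>: "integrable M (\<lambda>x. \<phi> (Z x))"
  proof (rule M.integrable_const_bound[where B = K])
    show "(\<lambda>x. \<phi> (Z x)) \<in> borel_measurable M"
      using M(2) borel_measurable_continuous_onI[OF \<phi>] by simp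
  qed (use M(3) K in auto)
  have intpow: "integrable M (\<lambda>x. Z x ^ k)" for k
    by (rule M.integrable_const_bound[where B = 1]) (use M pow in auto)
  have intg: "integrable M (\<lambda>x. g (Z x))" unfolding a using intpow by auto
  have "\<bar>(\<integral>x. \<phi> (Z x) \<partial>M) - (\<integral>x. g (Z x) \<partial>M)\<bar> = \<bar>\<integral>x. \<phi> (Z x) - g (Z x) \<partial>M\<bar>"
    using int\<phi> intg by simp
  also have "\<dots> \<le> (\<integral>x. \<bar>\<phi> (Z x) - g (Z x)\<bar> \<partial>M)" by (rule integral_abs_bound)
  also have "\<dots> \<le> (\<integral>x. e / 4 \<partial>M)"
    by (rule integral_mono_AE) (use int\<phi> intg M(3) g(2) in \<open>auto intro: less_imp_le\<close>)
  also have "\<dots> = e / 4" by (simp add: M.prob_space)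
  finally have "\<bar>(\<integral>x. \<phi> (Z x) \<partial>M) - (\<integral>x. g (Z x) \<partial>M)\<bar> \<le> e / 4" .
  then have "L * \<bar>(\<integral>x. \<phi> (Z x) \<partial>M) - (\<integral>x. g (Z x) \<partial>M)\<bar> \<le> 1 * (e / 4)"
    using L by (intro mult_mono) auto
  moreover have "L * \<bar>(\<integral>x. \<phi> (Z x) \<partial>M) - (\<integral>x. g (Z x) \<partial>M)\<bar>
      = \<bar>L * (\<integral>x. \<phi> (Z x) \<partial>M) - L * (\<integral>x. g (Z x) \<partial>M)\<bar>"
    using L by (simp add: abs_mult flip: right_diff_distrib)
  ultimately have lim_close: "\<bar>L * (\<integral>x. \<phi> (Z x) \<partial>M) - L * (\<integral>x. g (Z x) \<partial>M)\<bar> \<le> e / 4"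
    by simp
  have intp: "integrable (measure_pmf (p i)) (\<lambda>x. w x * h (Y i x))"
    if "\<And>y. y \<in> {0..1} \<Longrightarrow> \<bar>h y\<bar> \<le> K" "\<forall>x. Y i x \<in> {0..1}" for h K i
  proof (rule integrable_pmf_bounded[where B = "1 * K"])
    fix x
    have "\<bar>w x\<bar> * \<bar>h (Y i x)\<bar> \<le> 1 * K"
      using that(1)[of "Y i x"] that(2) w[of x] by (intro mult_mono) auto
    then show "\<bar>w x * h (Y i x)\<bar> \<le> 1 * K" by (simp add: abs_mult)
  qed
  have pre_close: "\<bar>measure_pmf.expectation (p i) (\<lambda>x. w x * \<phi> (Y i x))
        - measure_pmf.expectation (p i) (\<lambda>x. w x * g (Y i x))\<bar> \<le> e / 4"
    if Yi: "\<forall>x. Y i x \<in> {0..1}" for i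
  proof -
    have gK: "\<bar>g y\<bar> \<le> K + e / 4" if "y \<in> {0..1}" for y
      using g(2)[OF that] K[OF that] by linarith
    have "\<bar>measure_pmf.expectation (p i) (\<lambda>x. w x * \<phi> (Y i x))
        - measure_pmf.expectation (p i) (\<lambda>x. w x * g (Y i x))\<bar>
      = \<bar>measure_pmf.expectation (p i) (\<lambda>x. w x * \<phi> (Y i x) - w x * g (Y i x))\<bar>"
      using intp[of \<phi> K, OF K Yi] intp[of g "K + e / 4", OF gK Yi] by simp
    also have "\<dots> \<le> measure_pmf.expectation (p i) (\<lambda>x. e / 4)"
    proof (rule abs_expectation_le)
      fix x
      have "w x * \<bar>\<phi> (Y i x) - g (Y i x)\<bar> \<le> 1 * (e / 4)"
        using g(2)[of "Y i x"] Yi w[of x] by (intro mult_mono) (auto intro: less_imp_le)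
      then show "\<bar>w x * \<phi> (Y i x) - w x * g (Y i x)\<bar> \<le> e / 4"
        using w(1)[of x] by (simp add: abs_mult flip: right_diff_distrib)
    qed simp
    finally show ?thesis by simp
  qed
  have "((\<lambda>i. \<Sum>k\<le>n. a k * measure_pmf.expectation (p i) (\<lambda>x. w x * Y i x ^ k))
      \<longlongrightarrow> (\<Sum>k\<le>n. a k * (L * (\<integral>x. Z x ^ k \<partial>M)))) F"
    by (intro tendsto_intros moments)
  also have "(\<Sum>k\<le>n. a k * (L * (\<integral>x. Z x ^ k \<partial>M))) = L * (\<integral>x. g (Z x) \<partial>M)"
    unfolding a using intpow by (simp add: sum_distrib_left mult_ac)
  finally have "\<forall>\<^sub>F i in F. dist (\<Sum>k\<le>n. a k * measure_pmf.expectation (p i) (\<lambda>x. w x * Y i x ^ k))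
      (L * (\<integral>x. g (Z x) \<partial>M)) < e / 4"
    using \<open>0 < e\<close> by (intro tendstoD) auto
  with Y show "\<forall>\<^sub>F i in F. dist (measure_pmf.expectation (p i) (\<lambda>x. w x * \<phi> (Y i x)))
      (L * (\<integral>x. \<phi> (Z x) \<partial>M)) < e"
  proof eventually_elim
    case (elim i)
    have int: "integrable (measure_pmf (p i)) (\<lambda>x. w x * Y i x ^ k)" for k
      by (rule intp[of "\<lambda>y. y ^ k" 1]) (use pow elim in auto)
    have "(\<Sum>k\<le>n. a k * measure_pmf.expectation (p i) (\<lambda>x. w x * Y i x ^ k))
        = measure_pmf.expectation (p i) (\<lambda>x. \<Sum>k\<le>n. a k * (w x * Y i x ^ k))"
      using int by simp
    also have "\<dots> = measure_pmf.expectation (p i) (\<lambda>x. w x * g (Y i x))"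
      unfolding a by (simp add: sum_distrib_left mult_ac)
    finally show ?case
      using elim(2) pre_close[OF elim(1)] lim_close \<open>0 < e\<close>
      by (simp add: dist_real_def abs_if split: if_splits)
  qed
qed

text \<open>
  The indicator of \<open>[t, \<infinity>)\<close> lies between two ramps of width \<open>d\<close>, and by the
  continuity at \<open>t\<close> the integrals of the ramps are close to each other for small \<open>d\<close>.
\<close>
lemma moments_imp_tail:
  fixes p :: "'i \<Rightarrow> 's pmf" and w :: "'s \<Rightarrow> real" and Y :: "'i \<Rightarrow> 's \<Rightarrow> real"
    and M :: "'m measure" and Z :: "'m \<Rightarrow> real"
  assumes w: "\<And>x. 0 \<le> w x" "\<And>x. w x \<le> 1"
    and Y: "\<forall>\<^sub>F i in F. \<forall>x. Y i x \<in> {0..1}"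
    and M: "prob_space M" "Z \<in> borel_measurable M" "AE x in M. Z x \<in> {0..1}"
    and L: "0 \<le> L" "L \<le> 1"
    and moments: "\<And>k. ((\<lambda>i. measure_pmf.expectation (p i) (\<lambda>x. w x * Y i x ^ k))
                     \<longlongrightarrow> L * (\<integral>x. Z x ^ k \<partial>M)) F"
    and cont: "isCont (\<lambda>s. measure M {x \<in> space M. s \<le> Z x}) t"
  shows "((\<lambda>i. measure_pmf.expectation (p i) (\<lambda>x. w x * indicator {t..} (Y i x)))
           \<longlongrightarrow> L * measure M {x \<in> space M. t \<le> Z x}) F"
proof (rule tendstoI)
  fix e :: real assume "0 < e"
  interpret M: prob_space M by fact
  define G where "G s = measure M {x \<in> space M. s \<le> Z x}" for s
  define ramp where "ramp s d y = max 0 (min 1 ((y - s) / d))" for s d y :: real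
  have ramp01: "0 \<le> ramp s d y" "ramp s d y \<le> 1" for s d y by (auto simp: ramp_def)
  have ramp_le: "ramp s d y \<le> indicator {s..} y" if "0 < d" for s d y
    using that by (auto simp: ramp_def divide_le_0_iff split: split_indicator)
  have le_ramp: "indicator {s + d..} y \<le> ramp s d y" if "0 < d" for s d y
    using that by (auto simp: ramp_def le_divide_eq split: split_indicator)
  have cont_ramp: "continuous_on UNIV (ramp s d)" for s d
    unfolding ramp_def divide_inverse by (intro continuous_intros)
  have [measurable]: "Z \<in> borel_measurable M" by fact
  have meas: "{x \<in> space M. s \<le> Z x} \<in> sets M" for s by measurable
  have int_ind: "(\<integral>x. indicator {s..} (Z x) \<partial>M) = G s" for s
  proof -
    have "(\<integral>x. indicator {s..} (Z x) \<partial>M) = (\<integral>x. indicator {x \<in> space M. s \<le> Z x} x \<partial>M :: real)"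
      by (rule Bochner_Integration.integral_cong) (auto split: split_indicator)
    then show ?thesis using meas[of s] by (simp add: G_def)
  qed
  have ind: "integrable M (\<lambda>x. indicator {s..} (Z x) :: real)" for s
    by (rule M.integrable_const_bound[where B = 1]) (auto split: split_indicator)
  have ramp_meas: "ramp s d \<in> borel_measurable borel" for s d
    by (rule borel_measurable_continuous_onI[OF cont_ramp])
  have ramp_int: "integrable M (\<lambda>x. ramp s d (Z x))" for s d
    by (rule M.integrable_const_bound[where B = 1])
       (use ramp01 ramp_meas in \<open>auto simp: abs_of_nonneg\<close>)
  have upper: "(\<integral>x. ramp s d (Z x) \<partial>M) \<le> G s" if "0 < d" for s d
    unfolding int_ind[symmetric] by (rule integral_mono[OF ramp_int ind]) (rule ramp_le[OF that])
  have lower: "G (s + d) \<le> (\<integral>x. ramp s d (Z x) \<partial>M)" if "0 < d" for s d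
    unfolding int_ind[symmetric] by (rule integral_mono[OF ind ramp_int]) (rule le_ramp[OF that])
  from cont have "isCont G t" by (simp add: G_def[abs_def])
  then obtain d' where d': "0 < d'" "\<And>s. \<bar>s - t\<bar> < d' \<Longrightarrow> \<bar>G s - G t\<bar> < e / 2"
    unfolding continuous_at_eps_delta dist_real_def using \<open>0 < e\<close> by (meson half_gt_zero)
  define d where "d = d' / 2"
  have d: "0 < d" "\<bar>G (t + d) - G t\<bar> < e / 2" "\<bar>G (t - d) - G t\<bar> < e / 2"
    using d' by (auto simp: d_def)
  have scale: "L * a \<le> L * b" if "a \<le> b" for a b using that L(1) by (rule mult_left_mono)
  have L_small: "L * (e / 2) \<le> e / 2" using L \<open>0 < e\<close> mult_right_mono[of L 1 "e / 2"] by simp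
  have Lt1: "L * G t - e / 2 \<le> L * (\<integral>x. ramp t d (Z x) \<partial>M)"
  proof -
    have "G t - e / 2 \<le> (\<integral>x. ramp t d (Z x) \<partial>M)"
      using lower[OF d(1), of t] d(2) by linarith
    from scale[OF this] show ?thesis using L_small unfolding right_diff_distrib by linarith
  qed
  have Lt2: "L * (\<integral>x. ramp (t - d) d (Z x) \<partial>M) \<le> L * G t + e / 2"
  proof -
    have "(\<integral>x. ramp (t - d) d (Z x) \<partial>M) \<le> G t + e / 2"
      using upper[OF d(1), of "t - d"] d(3) by linarith
    from scale[OF this] show ?thesis using L_small unfolding distrib_left by linarith
  qed
  note functional = moments_imp_continuous_functional[OF w Y M L moments cont_ramp]
  have ev1: "\<forall>\<^sub>F i in F. dist (measure_pmf.expectation (p i) (\<lambda>x. w x * ramp t d (Y i x)))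
      (L * (\<integral>x. ramp t d (Z x) \<partial>M)) < e / 2"
    by (rule tendstoD[OF functional]) (use \<open>0 < e\<close> in simp)
  have ev2: "\<forall>\<^sub>F i in F. dist (measure_pmf.expectation (p i) (\<lambda>x. w x * ramp (t - d) d (Y i x)))
      (L * (\<integral>x. ramp (t - d) d (Z x) \<partial>M)) < e / 2"
    by (rule tendstoD[OF functional]) (use \<open>0 < e\<close> in simp)
  show "\<forall>\<^sub>F i in F. dist (measure_pmf.expectation (p i) (\<lambda>x. w x * indicator {t..} (Y i x)))
      (L * measure M {x \<in> space M. t \<le> Z x}) < e"
    using ev1 ev2
  proof eventually_elim
    case (elim i)
    have bd: "\<bar>w x * h\<bar> \<le> 1" if "0 \<le> h" "h \<le> 1" for x h
      using mult_mono[of "w x" 1 h 1] w that by (simp add: abs_mult)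
    have int_r: "integrable (measure_pmf (p i)) (\<lambda>x. w x * ramp s d (Y i x))" for s
      by (rule integrable_pmf_bounded[where B = 1]) (rule bd[OF ramp01])
    have int_i: "integrable (measure_pmf (p i)) (\<lambda>x. w x * indicator {t..} (Y i x))"
      by (rule integrable_pmf_bounded[where B = 1]) (rule bd, auto split: split_indicator)
    have "measure_pmf.expectation (p i) (\<lambda>x. w x * ramp t d (Y i x))
        \<le> measure_pmf.expectation (p i) (\<lambda>x. w x * indicator {t..} (Y i x))"
      by (rule integral_mono[OF int_r int_i]) (use ramp_le[OF d(1)] w in \<open>auto intro: mult_left_mono\<close>)
    moreover have "measure_pmf.expectation (p i) (\<lambda>x. w x * indicator {t..} (Y i x))
        \<le> measure_pmf.expectation (p i) (\<lambda>x. w x * ramp (t - d) d (Y i x))"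
    proof (rule integral_mono[OF int_i int_r])
      show "w x * indicator {t..} (Y i x) \<le> w x * ramp (t - d) d (Y i x)" for x
        using le_ramp[OF d(1), of "t - d" "Y i x"] w(1)[of x] by (intro mult_left_mono) auto
    qed
    ultimately have "\<bar>measure_pmf.expectation (p i) (\<lambda>x. w x * indicator {t..} (Y i x)) - L * G t\<bar> < e"
      using elim Lt1 Lt2 unfolding dist_real_def abs_less_iff by linarith
    then show ?case by (simp add: dist_real_def G_def)
  qed
qed

lemma exponential_laplace:
  assumes "0 < \<eta>"
  shows "(\<integral>x. exp (- x) ^ k \<partial>density lborel (exponential_density \<eta>)) = \<eta> / (\<eta> + real k)"
proof -
  have pos: "0 < \<eta> + real k" using assms by simp
  have "(\<integral>x. exp (- x) ^ k \<partial>density lborel (exponential_density \<eta>))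
      = (\<integral>x. exponential_density \<eta> x * exp (- x) ^ k \<partial>lborel)"
    using assms by (subst integral_density) (auto simp: exponential_density_nonneg)
  also have "\<dots> = (\<integral>x. \<eta> / (\<eta> + real k) * exponential_density (\<eta> + real k) x \<partial>lborel)"
  proof (rule Bochner_Integration.integral_cong[OF refl])
    fix x :: real
    have "exp (- x * \<eta>) * exp (- x) ^ k = exp (- x * (\<eta> + real k))"
      by (simp add: exp_of_nat_mult[symmetric] exp_add[symmetric] algebra_simps)
    then show "exponential_density \<eta> x * exp (- x) ^ k
        = \<eta> / (\<eta> + real k) * exponential_density (\<eta> + real k) x"
      using pos by (simp add: exponential_density_def mult.assoc)
  qed
  also have "\<dots> = \<eta> / (\<eta> + real k) * (\<integral>x. exponential_density (\<eta> + real k) x \<partial>lborel)"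
    by simp
  also have "(\<integral>x. exponential_density (\<eta> + real k) x \<partial>lborel)
      = (\<integral>x. 1 \<partial>density lborel (exponential_density (\<eta> + real k)))"
    using pos by (subst integral_density) (auto simp: exponential_density_nonneg)
  also have "\<dots> = 1"
    using prob_space.prob_space[OF prob_space_exponential_density[OF pos]] by simp
  finally show ?thesis by simp
qed

lemma exponential_survival:
  assumes "0 < \<eta>" "0 < s" "s \<le> 1"
  shows "measure (density lborel (exponential_density \<eta>))
           {x \<in> space (density lborel (exponential_density \<eta>)). s \<le> exp (- x)} = 1 - exp (ln s * \<eta>)"
proof -
  let ?E = "density lborel (exponential_density \<eta>)"
  interpret E: prob_space ?E by (rule prob_space_exponential_density[OF assms(1)])
  have "distributed ?E lborel (\<lambda>x. x) (exponential_density \<eta>)"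
    unfolding distributed_def using assms(1)
    by (auto simp: distr_id2 exponential_density_nonneg cong: distr_cong)
  from E.exponential_distributedD_le[OF this, of "- ln s"] assms
  have "E.prob {x \<in> space ?E. x \<le> - ln s} = 1 - exp (ln s * \<eta>)" by simp
  moreover have "s \<le> exp (- x) \<longleftrightarrow> x \<le> - ln s" for x
    using assms(2) by (metis exp_le_cancel_iff exp_ln le_minus_iff)
  ultimately show ?thesis by simp
qed

section \<open>The heavy-traffic limit\<close>

locale heavy_traffic =
  fixes lam1 mu1 mu2 :: real and lam2 :: "real \<Rightarrow> real" and k1 k2 :: nat
    and p :: "real \<Rightarrow> polling_state pmf"
  assumes lam1: "0 < lam1" and mu1: "0 < mu1" and mu2: "0 < mu2" and rho1: "lam1 / mu1 < 1"
    and k1: "0 < k1" and k2: "0 < k2"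
    and lam2: "\<And>\<delta>. lam2 \<delta> = mu2 * ((1 - lam1 / mu1) - \<delta>)"
    and queue1_stable: "lam1 / real k1 < mu2 * (1 - lam1 / mu1) / real k2"
    and stationary: "\<forall>\<^sub>F \<delta> in at_right 0. polling_stationary lam1 (lam2 \<delta>) mu1 mu2 k1 k2 (p \<delta>)"
begin

abbreviation "E \<delta> f \<equiv> measure_pmf.expectation (p \<delta>) f"

definition admissible :: "real \<Rightarrow> bool" where
  "admissible \<delta> \<longleftrightarrow> 0 < \<delta> \<and> subcritical_polling lam1 (lam2 \<delta>) mu1 mu2 k1 k2 (p \<delta>)"

lemma eventually_admissible: "\<forall>\<^sub>F \<delta> in at_right 0. admissible \<delta>"
proof -
  have "\<forall>\<^sub>F \<delta> in at_right 0. \<delta> \<in> {0<..<1 - lam1 / mu1}"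
    using rho1 by (intro eventually_at_right_real) simp
  with stationary show ?thesis
  proof eventually_elim
    case (elim \<delta>)
    then have "0 \<le> lam2 \<delta>" using mu2 by (simp add: lam2)
    with elim show ?case
      unfolding admissible_def using lam1 mu1 mu2 k1 k2 queue1_stable by (auto intro!: subcritical_polling.intro
        polling_system.intro subcritical_polling_axioms.intro)
  qed
qed

lemma lam2_tendsto: "(lam2 \<longlongrightarrow> mu2 * (1 - lam1 / mu1)) (at_right 0)"
proof -
  have "((\<lambda>\<delta>. mu2 * ((1 - lam1 / mu1) - \<delta>)) \<longlongrightarrow> mu2 * ((1 - lam1 / mu1) - 0)) (at_right 0)"
    by (intro tendsto_intros)
  then show ?thesis by (simp add: lam2[abs_def])
qed

abbreviation "qt \<equiv> polling_system.queue_transform mu1 mu2"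

text \<open>
  The normalisation in the Pollaczek-Khinchine formula is \<open>\<delta> + \<kappa> load_rate \<delta> \<kappa>\<close>, which isolates
  the small term \<open>\<delta>\<close> that vanishes in heavy traffic.
\<close>
definition load_rate :: "real \<Rightarrow> real \<Rightarrow> real" where
  "load_rate \<delta> \<kappa> = lam1 / (mu1 * (mu1 + \<kappa>)) + lam2 \<delta> / (mu2 * (mu2 + \<kappa>))"

lemma transform_value:
  assumes "admissible \<delta>" "0 < \<kappa>"
  shows "E \<delta> (qt \<kappa>) = \<delta> / (\<delta> + \<kappa> * load_rate \<delta> \<kappa>)"
proof -
  interpret S: subcritical_polling lam1 "lam2 \<delta>" mu1 mu2 k1 k2 "p \<delta>"
    using assms(1) by (simp add: admissible_def)
  have "0 < \<delta>" using assms(1) by (simp add: admissible_def)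
  have split: "l / m - l / (m + \<kappa>) = \<kappa> * (l / (m * (m + \<kappa>)))" if "0 < m" for l m
    using that assms(2) by (simp add: field_simps)
  have "1 - lam1 / mu1 - lam2 \<delta> / mu2 = \<delta>" using mu2 by (simp add: lam2)
  moreover have "1 - lam1 / (mu1 + \<kappa>) - lam2 \<delta> / (mu2 + \<kappa>)
      = (1 - lam1 / mu1 - lam2 \<delta> / mu2) + \<kappa> * load_rate \<delta> \<kappa>"
    using split[OF mu1, of lam1] split[OF mu2, of "lam2 \<delta>"]
    unfolding load_rate_def distrib_left by linarith
  ultimately have "(\<delta> + \<kappa> * load_rate \<delta> \<kappa>) * E \<delta> (qt \<kappa>) = \<delta>"
    using S.transform_idle[OF assms(2)] S.prob_idle by simp
  moreover have "0 < \<delta> + \<kappa> * load_rate \<delta> \<kappa>"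
    using \<open>0 < \<delta>\<close> assms(2) mu1 mu2 lam1 S.lam2 by (simp add: load_rate_def add_pos_nonneg)
  ultimately show ?thesis by (simp add: eq_divide_eq mult.commute)
qed

lemma queue1_tight:
  assumes "0 < \<epsilon>"
  obtains M where "\<And>\<delta>. admissible \<delta> \<Longrightarrow> measure_pmf.prob (p \<delta>) {x. M \<le> fst x} \<le> \<epsilon>"
proof -
  define C where "C = subcritical_polling.drift_const lam1 mu1 mu2 k1 k2
    / (2 * subcritical_polling.gap lam1 mu1 mu2 k1 k2)"
  obtain M :: nat where M: "C / \<epsilon> < real M" using reals_Archimedean2 by blast
  have "measure_pmf.prob (p \<delta>) {x. Suc M \<le> fst x} \<le> \<epsilon>" if "admissible \<delta>" for \<delta>
  proof -
    interpret S: subcritical_polling lam1 "lam2 \<delta>" mu1 mu2 k1 k2 "p \<delta>"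
      using that by (simp add: admissible_def)
    have "measure_pmf.prob (p \<delta>) {x. Suc M \<le> fst x} \<le> C / real (Suc M)"
      unfolding C_def by (rule S.queue1_tail) simp
    also have "\<dots> \<le> \<epsilon>"
    proof -
      have "C < \<epsilon> * real M" using M assms by (simp add: pos_divide_less_eq mult.commute)
      also have "\<dots> \<le> \<epsilon> * real (Suc M)" using assms by simp
      finally show ?thesis by (subst pos_divide_le_eq) auto
    qed
    finally show ?thesis .
  qed
  then show ?thesis by (rule that)
qed

text \<open>
  For fixed \<open>\<kappa>\<close> the expected transform is of order \<open>\<delta>\<close>, while it is bounded below on the event
  that both queues are short. A long first queue is excluded by tightness.
\<close>
lemma queue2_large: "((\<lambda>\<delta>. measure_pmf.prob (p \<delta>) {x. fst (snd x) \<le> 1}) \<longlongrightarrow> 0) (at_right 0)"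
proof (rule tendstoI)
  fix e :: real assume "0 < e"
  then obtain M where M: "\<And>\<delta>. admissible \<delta> \<Longrightarrow> measure_pmf.prob (p \<delta>) {x. M \<le> fst x} \<le> e / 2"
    using queue1_tight[of "e / 2"] by auto
  define r1 where "r1 = mu1 / (mu1 + 1)"
  define r2 where "r2 = mu2 / (mu2 + 1)"
  have r: "0 < r1" "r1 \<le> 1" "0 < r2" "r2 \<le> 1" using mu1 mu2 by (auto simp: r1_def r2_def)
  define K where "K = r1 ^ M * r2"
  have K: "0 < K" using r by (simp add: K_def)
  have "((\<lambda>\<delta>. \<delta> / (\<delta> + 1 * load_rate \<delta> 1))
      \<longlongrightarrow> 0 / (0 + 1 * (lam1 / (mu1 * (mu1 + 1)) + mu2 * (1 - lam1 / mu1) / (mu2 * (mu2 + 1)))))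
      (at_right 0)"
    unfolding load_rate_def
  proof (intro tendsto_intros lam2_tendsto)
    have pos: "0 < lam1 / (mu1 * (mu1 + 1)) + mu2 * (1 - lam1 / mu1) / (mu2 * (mu2 + 1))"
      using lam1 mu1 mu2 rho1 by (intro add_pos_pos divide_pos_pos mult_pos_pos) auto
    show "0 + 1 * (lam1 / (mu1 * (mu1 + 1)) + mu2 * (1 - lam1 / mu1) / (mu2 * (mu2 + 1))) \<noteq> 0"
      unfolding add_0 mult_1 using less_imp_neq[OF pos] by (rule not_sym)
  qed (use mu1 mu2 in auto)
  moreover have "\<forall>\<^sub>F \<delta> in at_right 0. \<delta> / (\<delta> + 1 * load_rate \<delta> 1) = E \<delta> (qt 1)"
    using eventually_admissible by eventually_elim (rule transform_value[symmetric], auto)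
  ultimately have "((\<lambda>\<delta>. E \<delta> (qt 1)) \<longlongrightarrow> 0) (at_right 0)"
    by (simp add: Lim_transform_eventually)
  then have "\<forall>\<^sub>F \<delta> in at_right 0. dist (E \<delta> (qt 1)) 0 < K * e / 2"
    using K \<open>0 < e\<close> by (intro tendstoD) auto
  with eventually_admissible
  show "\<forall>\<^sub>F \<delta> in at_right 0. dist (measure_pmf.prob (p \<delta>) {x. fst (snd x) \<le> 1}) 0 < e"
  proof eventually_elim
    case (elim \<delta>)
    interpret S: subcritical_polling lam1 "lam2 \<delta>" mu1 mu2 k1 k2 "p \<delta>"
      using elim(1) by (simp add: admissible_def)
    have q: "0 \<le> qt 1 x" for x by (rule S.queue_transform_bounds) simp
    have int: "integrable (measure_pmf (p \<delta>)) (qt 1)" by (rule S.integrable_queue_transform) simp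
    have "measure_pmf.prob (p \<delta>) {x. fst (snd x) \<le> 1} = E \<delta> (\<lambda>x. indicator {x. fst (snd x) \<le> 1} x)"
      by simp
    also have "\<dots> \<le> E \<delta> (\<lambda>x. indicator {x. M \<le> fst x} x + qt 1 x / K)"
    proof (rule integral_mono)
      show "integrable (measure_pmf (p \<delta>)) (\<lambda>x. indicator {x. M \<le> fst x} x + qt 1 x / K)"
        using int by simp
      fix x :: polling_state
      obtain n1 n2 s where x: "x = (n1, n2, s)" by (cases x)
      have "1 \<le> qt 1 x / K" if "n1 < M" "n2 \<le> 1"
      proof -
        have "K \<le> r1 ^ n1 * r2 ^ n2"
          unfolding K_def using that r power_decreasing[of n2 1 r2]
          by (intro mult_mono power_decreasing) auto
        then show ?thesis using K by (simp add: x S.queue_transform_def r1_def r2_def)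
      qed
      then show "indicator {x. fst (snd x) \<le> 1} x \<le> indicator {x. M \<le> fst x} x + qt 1 x / K"
        using q[of x] K by (auto simp: x not_le split: split_indicator)
    qed simp
    also have "\<dots> = measure_pmf.prob (p \<delta>) {x. M \<le> fst x} + E \<delta> (qt 1) / K"
      using int by simp
    also have "\<dots> < e / 2 + e / 2"
    proof (rule add_le_less_mono)
      show "E \<delta> (qt 1) / K < e / 2"
        using elim(2) K by (simp add: dist_real_def pos_divide_less_eq mult.commute)
    qed (rule M[OF elim(1)])
    finally show ?case by (simp add: dist_real_def)
  qed
qed

definition \<eta> :: real where "\<eta> = 1 / (1 - lam1 / mu1 + mu2 * (lam1 / mu1\<^sup>2))"

lemma eta_pos: "0 < \<eta>"
proof -
  have "0 < mu2 * (lam1 / mu1\<^sup>2)" using lam1 mu1 mu2 by simp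
  then have "0 < 1 - lam1 / mu1 + mu2 * (lam1 / mu1\<^sup>2)" using rho1 by linarith
  then show ?thesis by (simp add: \<eta>_def)
qed

lemma transform_limit:
  assumes "(\<kappa> \<longlongrightarrow> 0) (at_right 0)" "((\<lambda>\<delta>. \<kappa> \<delta> / \<delta>) \<longlongrightarrow> mu2 * c) (at_right 0)"
    and "\<And>\<delta>. 0 < \<delta> \<Longrightarrow> 0 < \<kappa> \<delta>" and "0 \<le> c"
  shows "((\<lambda>\<delta>. E \<delta> (qt (\<kappa> \<delta>))) \<longlongrightarrow> \<eta> / (\<eta> + c)) (at_right 0)"
proof -
  let ?R = "lam1 / (mu1 * (mu1 + 0)) + mu2 * (1 - lam1 / mu1) / (mu2 * (mu2 + 0))"
  have R: "mu2 * ?R = 1 / \<eta>" using mu2 mu1 by (simp add: \<eta>_def power2_eq_square field_simps)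
  have val: "1 + mu2 * c * ?R = (\<eta> + c) / \<eta>"
  proof -
    have "mu2 * c * ?R = c * (mu2 * ?R)" by (simp only: mult_ac)
    then show ?thesis using eta_pos by (simp only: R) (simp add: field_simps)
  qed
  have "((\<lambda>\<delta>. 1 / (1 + \<kappa> \<delta> / \<delta> * load_rate \<delta> (\<kappa> \<delta>))) \<longlongrightarrow> 1 / (1 + mu2 * c * ?R)) (at_right 0)"
    unfolding load_rate_def
  proof (intro tendsto_intros lam2_tendsto assms(1,2))
    show "1 + mu2 * c * ?R \<noteq> 0" unfolding val using eta_pos assms(4) by simp
  qed (use mu1 mu2 in auto)
  also have "1 / (1 + mu2 * c * ?R) = \<eta> / (\<eta> + c)" unfolding val by simp
  finally have lim: "((\<lambda>\<delta>. 1 / (1 + \<kappa> \<delta> / \<delta> * load_rate \<delta> (\<kappa> \<delta>))) \<longlongrightarrow> \<eta> / (\<eta> + c)) (at_right 0)" .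
  have "\<forall>\<^sub>F \<delta> in at_right 0. 1 / (1 + \<kappa> \<delta> / \<delta> * load_rate \<delta> (\<kappa> \<delta>)) = E \<delta> (qt (\<kappa> \<delta>))"
    using eventually_admissible
  proof eventually_elim
    case (elim \<delta>)
    then have "0 < \<delta>" by (simp add: admissible_def)
    then have "\<delta> + \<kappa> \<delta> * load_rate \<delta> (\<kappa> \<delta>) = \<delta> * (1 + \<kappa> \<delta> / \<delta> * load_rate \<delta> (\<kappa> \<delta>))"
      by (simp add: distrib_left)
    then show ?case using transform_value[OF elim assms(3)[OF \<open>0 < \<delta>\<close>]] \<open>0 < \<delta>\<close> by simp
  qed
  with lim show ?thesis by (rule Lim_transform_eventually)
qed

text \<open>
  Choosing \<open>\<kappa> = mu2 (e\<^bsup>k \<delta>\<^esup> - 1)\<close> makes the second factor of the transform exactly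
  \<open>e\<^bsup>-k \<delta> N2\<^esup>\<close>. The first factor has a base tending to 1 and a tight exponent.
\<close>
lemma queue2_laplace:
  "((\<lambda>\<delta>. E \<delta> (\<lambda>x. exp (- (real k * \<delta>)) ^ fst (snd x))) \<longlongrightarrow> \<eta> / (\<eta> + real k)) (at_right 0)"
proof (cases "k = 0")
  case True
  then show ?thesis using eta_pos by simp
next
  case False
  define \<kappa> where "\<kappa> \<delta> = mu2 * (exp (real k * \<delta>) - 1)" for \<delta>
  define u where "u \<delta> = exp (- (real k * \<delta>))" for \<delta>
  have \<kappa>_pos: "0 < \<kappa> \<delta>" if "0 < \<delta>" for \<delta>
    using that False mu2 by (simp add: \<kappa>_def)
  have "((\<lambda>\<delta>. mu2 * (exp (real k * \<delta>) - 1)) \<longlongrightarrow> mu2 * (exp (real k * 0) - 1)) (at_right 0)"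
    by (intro tendsto_intros)
  then have \<kappa>_0: "(\<kappa> \<longlongrightarrow> 0) (at_right 0)" by (simp add: \<kappa>_def[abs_def])
  have "((\<lambda>\<delta>. exp (real k * \<delta>)) has_real_derivative real k) (at 0)"
    by (auto intro!: derivative_eq_intros)
  then have "((\<lambda>\<delta>. (exp (real k * \<delta>) - exp (real k * 0)) / (\<delta> - 0)) \<longlongrightarrow> real k) (at 0)"
    unfolding has_field_derivative_iff .
  then have "((\<lambda>\<delta>. (exp (real k * \<delta>) - 1) / \<delta>) \<longlongrightarrow> real k) (at_right 0)"
    by (intro tendsto_mono[OF at_le[of "{0<..}" UNIV]]) simp_all
  from tendsto_mult_left[OF this, of mu2]
  have \<kappa>_rate: "((\<lambda>\<delta>. \<kappa> \<delta> / \<delta>) \<longlongrightarrow> mu2 * real k) (at_right 0)" by (simp add: \<kappa>_def)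
  have main: "((\<lambda>\<delta>. E \<delta> (qt (\<kappa> \<delta>))) \<longlongrightarrow> \<eta> / (\<eta> + real k)) (at_right 0)"
    by (rule transform_limit[OF \<kappa>_0 \<kappa>_rate \<kappa>_pos]) auto
  have "((\<lambda>\<delta>. E \<delta> (\<lambda>x. u \<delta> ^ fst (snd x)) - E \<delta> (qt (\<kappa> \<delta>))) \<longlongrightarrow> 0) (at_right 0)"
  proof (rule tendstoI)
    fix e :: real assume "0 < e"
    then obtain M where M: "\<And>\<delta>. admissible \<delta> \<Longrightarrow> measure_pmf.prob (p \<delta>) {x. M \<le> fst x} \<le> e / 2"
      using queue1_tight[of "e / 2"] by auto
    have "((\<lambda>\<delta>. (mu1 / (mu1 + \<kappa> \<delta>)) ^ M) \<longlongrightarrow> (mu1 / (mu1 + 0)) ^ M) (at_right 0)"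
      using mu1 by (intro tendsto_intros \<kappa>_0) auto
    then have "\<forall>\<^sub>F \<delta> in at_right 0. dist ((mu1 / (mu1 + \<kappa> \<delta>)) ^ M) 1 < e / 2"
      using mu1 \<open>0 < e\<close> by (intro tendstoD) auto
    with eventually_admissible show "\<forall>\<^sub>F \<delta> in at_right 0.
        dist (E \<delta> (\<lambda>x. u \<delta> ^ fst (snd x)) - E \<delta> (qt (\<kappa> \<delta>))) 0 < e"
    proof eventually_elim
      case (elim \<delta>)
      interpret S: subcritical_polling lam1 "lam2 \<delta>" mu1 mu2 k1 k2 "p \<delta>"
        using elim(1) by (simp add: admissible_def)
      have \<delta>: "0 < \<delta>" using elim(1) by (simp add: admissible_def)
      have \<kappa>: "0 < \<kappa> \<delta>" by (rule \<kappa>_pos[OF \<delta>])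
      define r where "r = mu1 / (mu1 + \<kappa> \<delta>)"
      have r: "0 \<le> r" "r \<le> 1" using mu1 \<kappa> by (auto simp: r_def)
      have u: "0 \<le> u \<delta>" "u \<delta> \<le> 1" using \<delta> by (auto simp: u_def)
      have "mu2 / (mu2 + \<kappa> \<delta>) = u \<delta>"
        using mu2 by (simp add: \<kappa>_def u_def exp_minus field_simps)
      then have qt: "qt (\<kappa> \<delta>) x = r ^ fst x * u \<delta> ^ fst (snd x)" for x
        by (simp add: S.queue_transform_def r_def case_prod_unfold)
      have int1: "integrable (measure_pmf (p \<delta>)) (\<lambda>x. u \<delta> ^ fst (snd x))"
        by (rule integrable_pmf_bounded[where B = 1]) (use u in \<open>simp add: power_le_one\<close>)
      have int2: "integrable (measure_pmf (p \<delta>)) (qt (\<kappa> \<delta>))"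
        by (rule S.integrable_queue_transform) (use \<kappa> in simp)
      have "\<bar>E \<delta> (\<lambda>x. u \<delta> ^ fst (snd x)) - E \<delta> (qt (\<kappa> \<delta>))\<bar>
          = \<bar>E \<delta> (\<lambda>x. u \<delta> ^ fst (snd x) - qt (\<kappa> \<delta>) x)\<bar>"
        using int1 int2 by simp
      also have "\<dots> \<le> E \<delta> (\<lambda>x. indicator {x. M \<le> fst x} x + (1 - r ^ M))"
      proof (rule abs_expectation_le)
        fix x :: polling_state
        have a: "u \<delta> ^ fst (snd x) - qt (\<kappa> \<delta>) x = u \<delta> ^ fst (snd x) * (1 - r ^ fst x)"
          by (simp add: qt algebra_simps)
        have b: "0 \<le> 1 - r ^ n" "1 - r ^ n \<le> 1" for n using r by (auto simp: power_le_one)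
        have nonneg: "0 \<le> u \<delta> ^ fst (snd x) * (1 - r ^ fst x)" using u b(1) by simp
        have "u \<delta> ^ fst (snd x) * (1 - r ^ fst x) \<le> 1 * (1 - r ^ fst x)"
          using u b(1) by (intro mult_right_mono power_le_one) auto
        moreover have "1 - r ^ fst x \<le> indicator {x. M \<le> fst x} x + (1 - r ^ M)"
        proof (cases "M \<le> fst x")
          case True
          then show ?thesis using b(1)[of M] b(2)[of "fst x"] by simp
        next
          case False
          then have "r ^ M \<le> r ^ fst x" using r by (intro power_decreasing) auto
          then show ?thesis using False by simp
        qed
        ultimately show "\<bar>u \<delta> ^ fst (snd x) - qt (\<kappa> \<delta>) x\<bar> \<le> indicator {x. M \<le> fst x} x + (1 - r ^ M)"
          unfolding a abs_of_nonneg[OF nonneg] mult_1 by (rule order_trans)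
      qed simp
      also have "\<dots> = measure_pmf.prob (p \<delta>) {x. M \<le> fst x} + (1 - r ^ M)" by simp
      also have "\<dots> < e"
        using M[OF elim(1)] elim(2) unfolding r_def[symmetric] dist_real_def by linarith
      finally show ?case by (simp add: dist_real_def)
    qed
  qed
  from tendsto_add[OF this main] show ?thesis by (simp add: u_def)
qed

text \<open>
  The law of the first queue and the server, reweighted by \<open>e\<^bsup>-k \<delta> N2\<^esup>\<close> and normalised, is tight
  and nearly balanced for the vacation queue, hence converges to \<open>v\<close>. The normalising constant
  carries the exponential factor.
\<close>
lemma joint_laplace:
  assumes v: "vacation_stationary lam1 mu1 mu2 k1 k2 v" and h: "\<And>y. \<bar>h y\<bar> \<le> B"
  shows "((\<lambda>\<delta>. E \<delta> (\<lambda>x. h (vacation_view x) * exp (- (real k * \<delta>)) ^ fst (snd x)))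
           \<longlongrightarrow> measure_pmf.expectation v h * (\<eta> / (\<eta> + real k))) (at_right 0)"
proof -
  let ?V = "vacation_states k1 k2" and ?m = "vacation_moves lam1 mu1 mu2 k1 k2"
  define w where "w \<delta> x = exp (- (real k * \<delta>)) ^ fst (snd x)" for \<delta> and x :: polling_state
  define c where "c = \<eta> / (\<eta> + real k)"
  interpret V: bounded_rate_chain ?V ?m "lam1 + mu1 + mu2"
    by (rule vacation_chain[OF lam1 mu1 mu2 k1 k2])
  have vstat: "stationary_distribution ?V (generator ?m) v"
    using v by (simp add: vacation_stationary_def)
  then have vS: "set_pmf v \<subseteq> ?V" by (simp add: stationary_distribution_def)
  have "0 < c" using eta_pos by (simp add: c_def)
  have lim_w: "((\<lambda>\<delta>. E \<delta> (w \<delta>)) \<longlongrightarrow> c) (at_right 0)"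
    using queue2_laplace[of k] by (simp add: w_def[abs_def] c_def)
  have "\<forall>\<^sub>F \<delta> in at_right 0. c / 2 < E \<delta> (w \<delta>)"
    using lim_w \<open>0 < c\<close> by (intro order_tendstoD) auto
  with eventually_admissible have ev: "\<forall>\<^sub>F \<delta> in at_right 0. admissible \<delta> \<and> c / 2 < E \<delta> (w \<delta>)"
    by (rule eventually_conj)
  have w01: "0 \<le> w \<delta> x" "w \<delta> x \<le> 1" if "admissible \<delta>" for \<delta> x
    using that by (auto simp: w_def admissible_def intro!: power_le_one)
  \<comment> \<open>For \<open>\<delta>\<close> that is not small, any law on the vacation states serves as a filler.\<close>
  define is_tilt where "is_tilt \<delta> q \<longleftrightarrow> set_pmf q \<subseteq> ?V \<and> (admissible \<delta> \<and> c / 2 < E \<delta> (w \<delta>) \<longrightarrow>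
      (\<forall>f :: vacation_state \<Rightarrow> real.
         measure_pmf.expectation q f = E \<delta> (\<lambda>x. f (vacation_view x) * w \<delta> x) / E \<delta> (w \<delta>)))"
    for \<delta> q
  have "\<exists>q. is_tilt \<delta> q" for \<delta>
  proof (cases "admissible \<delta> \<and> c / 2 < E \<delta> (w \<delta>)")
    case True
    then interpret S: subcritical_polling lam1 "lam2 \<delta>" mu1 mu2 k1 k2 "p \<delta>"
      by (simp add: admissible_def)
    from True have "admissible \<delta>" "0 < E \<delta> (w \<delta>)" using \<open>0 < c\<close> by auto
    from tilted_pmf[of "w \<delta>" "p \<delta>", OF w01[OF this(1)] this(2)] obtain q
      where q: "set_pmf q \<subseteq> set_pmf (p \<delta>)"
        "\<And>f :: polling_state \<Rightarrow> real.
           measure_pmf.expectation q f = E \<delta> (\<lambda>x. f x * w \<delta> x) / E \<delta> (w \<delta>)"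
      by auto
    have "set_pmf (map_pmf vacation_view q) \<subseteq> ?V"
      using q(1) S.supp by (auto intro!: S.vacation_view_in simp del: vacation_view.simps)
    moreover have "measure_pmf.expectation (map_pmf vacation_view q) f
        = E \<delta> (\<lambda>x. f (vacation_view x) * w \<delta> x) / E \<delta> (w \<delta>)" for f :: "vacation_state \<Rightarrow> real"
      using q(2) by simp
    ultimately show ?thesis unfolding is_tilt_def by blast
  next
    case False
    then show ?thesis unfolding is_tilt_def using vS by blast
  qed
  then obtain m where m0: "\<And>\<delta>. is_tilt \<delta> (m \<delta>)" by metis
  note m0 = m0[unfolded is_tilt_def]
  have mS: "set_pmf (m \<delta>) \<subseteq> ?V" for \<delta> using m0 by (rule conjunct1)
  have m: "measure_pmf.expectation (m \<delta>) f = E \<delta> (\<lambda>x. f (vacation_view x) * w \<delta> x) / E \<delta> (w \<delta>)"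
    if "admissible \<delta> \<and> c / 2 < E \<delta> (w \<delta>)" for \<delta> and f :: "vacation_state \<Rightarrow> real"
    using m0[THEN conjunct2, THEN mp, OF that] by (rule spec)
  have lim_m: "((\<lambda>\<delta>. measure_pmf.expectation (m \<delta>) h) \<longlongrightarrow> measure_pmf.expectation v h) (at_right 0)"
  proof (rule V.nearly_balanced_tendsto[OF mS])
    fix \<epsilon> :: real assume "0 < \<epsilon>"
    with \<open>0 < c\<close> obtain M
      where M: "\<And>\<delta>. admissible \<delta> \<Longrightarrow> measure_pmf.prob (p \<delta>) {x. M \<le> fst x} \<le> \<epsilon> * c / 2"
      using queue1_tight[of "\<epsilon> * c / 2"] by auto
    define A where "A = {y \<in> ?V. fst y < M}"
    have "A \<subseteq> {..<M} \<times> (Serving ` {..<k1} \<union> Vacation ` {..<k2})"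
      by (auto simp: A_def vacation_states_def)
    then have "finite A" by (rule finite_subset) auto
    moreover have "\<forall>\<^sub>F \<delta> in at_right 0. 1 - \<epsilon> \<le> measure_pmf.prob (m \<delta>) A"
      using ev
    proof eventually_elim
      case (elim \<delta>)
      interpret S: subcritical_polling lam1 "lam2 \<delta>" mu1 mu2 k1 k2 "p \<delta>"
        using elim by (simp add: admissible_def)
      have "1 - measure_pmf.prob (m \<delta>) A = measure_pmf.expectation (m \<delta>) (indicator (- A))"
        using measure_pmf.prob_compl[of A "m \<delta>"] by (simp add: Compl_eq_Diff_UNIV)
      also have "\<dots> = E \<delta> (\<lambda>x. indicator (- A) (vacation_view x) * w \<delta> x) / E \<delta> (w \<delta>)"
        by (rule m[OF elim])
      also have "\<dots> \<le> E \<delta> (\<lambda>x. indicator {x. M \<le> fst x} x) / E \<delta> (w \<delta>)"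
      proof (rule divide_right_mono)
        show "E \<delta> (\<lambda>x. indicator (- A) (vacation_view x) * w \<delta> x)
            \<le> E \<delta> (\<lambda>x. indicator {x. M \<le> fst x} x)"
        proof (rule integral_mono_AE)
          show "integrable (measure_pmf (p \<delta>)) (\<lambda>x. indicator (- A) (vacation_view x) * w \<delta> x)"
            by (rule integrable_pmf_bounded[where B = 1])
               (use w01 elim in \<open>auto simp: abs_of_nonneg split: split_indicator\<close>)
          have "indicator (- A) (vacation_view x) * w \<delta> x \<le> indicator {x. M \<le> fst x} x"
            if "x \<in> S.states" for x
          proof -
            have "fst (vacation_view x) = fst x" by (cases x rule: vacation_view.cases) auto
            then show ?thesis
              using S.vacation_view_in[OF that] w01[of \<delta> x] elim
              by (auto simp: A_def split: split_indicator)
          qed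
          then show "AE x in measure_pmf (p \<delta>).
              indicator (- A) (vacation_view x) * w \<delta> x \<le> indicator {x. M \<le> fst x} x"
            using S.supp by (auto simp: AE_measure_pmf_iff)
        qed simp
      qed (use elim \<open>0 < c\<close> in auto)
      also have "\<dots> \<le> (\<epsilon> * c / 2) / (c / 2)"
        using M[of \<delta>] elim \<open>0 < c\<close> \<open>0 < \<epsilon>\<close> by (intro frac_le) auto
      finally show ?case using \<open>0 < c\<close> by simp
    qed
    ultimately show "\<exists>A. finite A \<and> (\<forall>\<^sub>F \<delta> in at_right 0. 1 - \<epsilon> \<le> measure_pmf.prob (m \<delta>) A)"
      by blast
  next
    fix f :: "vacation_state \<Rightarrow> real" and C assume f: "\<And>y. \<bar>f y\<bar> \<le> C"
    let ?bound = "\<lambda>\<delta>. (C * (lam2 \<delta> + mu2) * (1 - exp (- (real k * \<delta>)))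
        + 4 * C * (lam1 + lam2 \<delta> + mu1 + mu2) * measure_pmf.prob (p \<delta>) {x. fst (snd x) \<le> 1})
        / E \<delta> (w \<delta>)"
    have "(?bound \<longlongrightarrow> (C * (mu2 * (1 - lam1 / mu1) + mu2) * (1 - exp (- (real k * 0)))
        + 4 * C * (lam1 + mu2 * (1 - lam1 / mu1) + mu1 + mu2) * 0) / c) (at_right 0)"
      using \<open>0 < c\<close> by (intro tendsto_intros lam2_tendsto queue2_large lim_w) auto
    then have "(?bound \<longlongrightarrow> 0) (at_right 0)" by simp
    then show "((\<lambda>\<delta>. measure_pmf.expectation (m \<delta>) (drift ?m f)) \<longlongrightarrow> 0) (at_right 0)"
    proof (rule Lim_null_comparison[rotated])
      show "\<forall>\<^sub>F \<delta> in at_right 0. norm (measure_pmf.expectation (m \<delta>) (drift ?m f)) \<le> ?bound \<delta>"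
        using ev
      proof eventually_elim
        case (elim \<delta>)
        interpret S: subcritical_polling lam1 "lam2 \<delta>" mu1 mu2 k1 k2 "p \<delta>"
          using elim by (simp add: admissible_def)
        have "\<bar>E \<delta> (\<lambda>x. drift ?m f (vacation_view x) * w \<delta> x)\<bar>
          \<le> C * (lam2 \<delta> + mu2) * (1 - exp (- (real k * \<delta>)))
            + 4 * C * (lam1 + lam2 \<delta> + mu1 + mu2) * measure_pmf.prob (p \<delta>) {x. fst (snd x) \<le> 1}"
          unfolding w_def by (rule S.vacation_drift_small) (use f elim in \<open>auto simp: admissible_def\<close>)
        then show ?case
          using elim \<open>0 < c\<close> by (simp add: m[OF elim] abs_divide divide_right_mono)
      qed
    qed
  next
    show "measure_pmf.expectation v (drift ?m f) = 0" if "\<And>y. \<bar>f y\<bar> \<le> C" for f C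
      by (rule V.stationary_drift_zero[OF vstat that])
  next
    show "(y, (0, Vacation 0)) \<in> (step_rel ?m)\<^sup>*" if "y \<in> ?V" for y
      by (rule vacation_reaches_empty[OF lam1 mu1 mu2 k1 k2 that])
  qed (rule vS, rule h)
  have "((\<lambda>\<delta>. measure_pmf.expectation (m \<delta>) h * E \<delta> (w \<delta>))
      \<longlongrightarrow> measure_pmf.expectation v h * c) (at_right 0)"
    by (intro tendsto_mult lim_m lim_w)
  moreover have "\<forall>\<^sub>F \<delta> in at_right 0. measure_pmf.expectation (m \<delta>) h * E \<delta> (w \<delta>)
      = E \<delta> (\<lambda>x. h (vacation_view x) * w \<delta> x)"
    using ev
  proof eventually_elim
    case (elim \<delta>)
    then have "E \<delta> (w \<delta>) \<noteq> 0" using \<open>0 < c\<close> by auto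
    then show ?case by (simp add: m[OF elim])
  qed
  ultimately show ?thesis unfolding c_def w_def by (rule Lim_transform_eventually)
qed

lemma joint_limit:
  assumes v: "vacation_stationary lam1 mu1 mu2 k1 k2 v" and "0 < \<xi>"
  shows "((\<lambda>\<delta>. measure_pmf.prob (p \<delta>) {(N1, N2, s). N1 \<le> n1 \<and> \<delta> * real N2 \<le> \<xi>})
           \<longlongrightarrow> measure_pmf.prob v {(N, s). N \<le> n1} * (1 - exp (- \<eta> * \<xi>)))
         (at_right 0)"
proof -
  let ?A = "{y :: vacation_state. fst y \<le> n1}"
  define L where "L = measure_pmf.prob v ?A"
  \<comment> \<open>With \<open>Y\<close> for \<open>e\<^bsup>-\<delta> N2\<^esup>\<close>, the event \<open>\<delta> N2 \<le> \<xi>\<close> becomes \<open>e\<^bsup>-\<xi>\<^esup> \<le> Y\<close>.\<close>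
  define w :: "polling_state \<Rightarrow> real" where "w x = indicator ?A (vacation_view x)" for x
  define Y :: "real \<Rightarrow> polling_state \<Rightarrow> real" where "Y \<delta> x = exp (- (\<delta> * real (fst (snd x))))" for \<delta> x
  let ?M = "density lborel (exponential_density \<eta>)"
  interpret M: prob_space ?M by (rule prob_space_exponential_density[OF eta_pos])
  define t where "t = exp (- \<xi>)"
  have t: "0 < t" "t < 1" using \<open>0 < \<xi>\<close> by (auto simp: t_def)
  have w_eq: "w x = of_bool (fst x \<le> n1)" for x
    by (cases x rule: vacation_view.cases) (auto simp: w_def)
  have "((\<lambda>\<delta>. E \<delta> (\<lambda>x. w x * indicator {t..} (Y \<delta> x)))
      \<longlongrightarrow> L * measure ?M {x \<in> space ?M. t \<le> exp (- x)}) (at_right 0)"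
  proof (rule moments_imp_tail)
    show "\<forall>\<^sub>F \<delta> in at_right 0. \<forall>x. Y \<delta> x \<in> {0..1}"
      using eventually_at_right_less[of 0] by eventually_elim (auto simp: Y_def)
    have "AE x in ?M. 0 \<le> x"
      using eta_pos by (subst AE_density) (auto simp: exponential_density_def)
    then show "AE x in ?M. exp (- x) \<in> {0..1}" by eventually_elim auto
    show "((\<lambda>\<delta>. E \<delta> (\<lambda>x. w x * Y \<delta> x ^ k)) \<longlongrightarrow> L * (\<integral>x. exp (- x) ^ k \<partial>?M)) (at_right 0)" for k
    proof -
      have pow: "Y \<delta> x ^ k = exp (- (real k * \<delta>)) ^ fst (snd x)" for \<delta> x
        by (simp add: Y_def exp_of_nat_mult[symmetric] mult_ac)
      have "\<bar>indicator ?A y :: real\<bar> \<le> 1" for y by (auto split: split_indicator)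
      from joint_laplace[where h = "indicator ?A" and k = k, OF v this] show ?thesis
        unfolding pow w_def L_def exponential_laplace[OF eta_pos] by simp
    qed
    have "isCont (\<lambda>s. 1 - exp (ln s * \<eta>)) t" using t by (intro continuous_intros) auto
    moreover have "\<forall>\<^sub>F s in nhds t. 1 - exp (ln s * \<eta>)
        = measure ?M {x \<in> space ?M. s \<le> exp (- x)}"
    proof (rule eventually_mono)
      show "\<forall>\<^sub>F s in nhds t. s \<in> {0<..<1}" using t by (intro eventually_nhds_in_open) auto
      show "1 - exp (ln s * \<eta>) = measure ?M {x \<in> space ?M. s \<le> exp (- x)}"
        if "s \<in> {0<..<1}" for s
        using that by (intro exponential_survival[OF eta_pos, symmetric]) auto
    qed
    ultimately show "isCont (\<lambda>s. measure ?M {x \<in> space ?M. s \<le> exp (- x)}) t"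
      by (simp only: isCont_cong)
  qed (auto simp: w_def L_def M.prob_space_axioms split: split_indicator)
  moreover have "measure ?M {x \<in> space ?M. t \<le> exp (- x)} = 1 - exp (- \<eta> * \<xi>)"
    using exponential_survival[OF eta_pos t(1)] t(2) by (simp add: t_def mult.commute)
  moreover have "E \<delta> (\<lambda>x. w x * indicator {t..} (Y \<delta> x))
      = measure_pmf.prob (p \<delta>) {(N1, N2, s). N1 \<le> n1 \<and> \<delta> * real N2 \<le> \<xi>}" for \<delta>
  proof -
    have "w x * indicator {t..} (Y \<delta> x)
        = indicator {(N1, N2, s). N1 \<le> n1 \<and> \<delta> * real N2 \<le> \<xi>} x" for x
      by (cases x) (auto simp: w_eq Y_def t_def split: split_indicator)
    then show ?thesis by simp
  qed
  moreover have "L = measure_pmf.prob v {(N, s). N \<le> n1}"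
    by (simp add: L_def case_prod_unfold)
  ultimately show ?thesis by simp
qed

end

theorem mainTheorem1:
  fixes lam1 mu1 mu2 \<eta> \<xi> :: real
    and lam2 :: "real \<Rightarrow> real"
    and k1 k2 n1 :: nat
    and p :: "real \<Rightarrow> polling_state pmf"
    and v :: "vacation_state pmf"
  assumes "0 < lam1" and "0 < mu1" and "0 < mu2"
    and "lam1 / mu1 < 1"
    and "0 < k1" and "0 < k2"
    and "\<And>\<delta>. lam2 \<delta> = mu2 * ((1 - lam1 / mu1) - \<delta>)"
    and "\<forall>\<^sub>F \<delta> in at_right 0. lam1 / real k1 < lam2 \<delta> / real k2"
    and "\<forall>\<^sub>F \<delta> in at_right 0. polling_stationary lam1 (lam2 \<delta>) mu1 mu2 k1 k2 (p \<delta>)"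
    and "vacation_stationary lam1 mu1 mu2 k1 k2 v"
    and "1 / \<eta> = 1 - lam1 / mu1 + mu2 * (lam1 / mu1\<^sup>2)"
    and "0 < \<xi>"
  shows "((\<lambda>\<delta>. measure_pmf.prob (p \<delta>) {(N1, N2, s). N1 \<le> n1 \<and> \<delta> * real N2 \<le> \<xi>})
           \<longlongrightarrow> measure_pmf.prob v {(N, s). N \<le> n1} * (1 - exp (- \<eta> * \<xi>)))
         (at_right 0)"
proof -
  have "\<forall>\<^sub>F \<delta> in at_right (0::real). 0 < \<delta>" by (rule eventually_at_right_less)
  from eventually_conj[OF this assms(8)]
  have "\<exists>\<delta>. 0 < \<delta> \<and> lam1 / real k1 < lam2 \<delta> / real k2"
    by (rule eventually_happens'[rotated]) simp
  then obtain \<delta> where \<delta>: "0 < \<delta>" "lam1 / real k1 < lam2 \<delta> / real k2" by blast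
  have "lam2 \<delta> \<le> mu2 * (1 - lam1 / mu1)" unfolding assms(7) using \<delta>(1) assms(3) by simp
  then have "lam2 \<delta> / real k2 \<le> mu2 * (1 - lam1 / mu1) / real k2" by (rule divide_right_mono) simp
  with \<delta>(2) have "lam1 / real k1 < mu2 * (1 - lam1 / mu1) / real k2" by linarith
  then interpret heavy_traffic lam1 mu1 mu2 lam2 k1 k2 p
    using assms by unfold_locales auto
  have "\<eta> = 1 / (1 - lam1 / mu1 + mu2 * (lam1 / mu1\<^sup>2))"
    unfolding assms(11)[symmetric] by simp
  then show ?thesis using joint_limit[OF assms(10,12), of n1] by (simp add: \<eta>_def)
qed

end
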